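(* Let $\left(X,(\|\cdot\|_i)_{i\in I}\right)$ be a q-normed space. The following conditions on $X$ are equivalent. (i) $\{0\}$ is located in $X$. (ii) Every element of $X$ is normable. (iii) Every singleton subset of $X$ is located. (iv) Every finitely enumerable subset of $X$ is located.
   Context: Setting: Bishop-style constructive mathematics (BISH: intuitionistic logic with dependent choice). All linear spaces are real. A q-normed space is a pair $(X,(\|\cdot\|_i)_{i\in I})$ where $X$ is a real linear space and $(\|\cdot\|_i)_{i\in I}$ (the q-norm) is a family of seminorms on $X$, indexed by an inhabited set $I$, such that for each $x\in X$ the set $\{\|x\|_i:i\in I\}$ is bounded in $\mathbf{R}$. Equality and inequality: $x=y$ iff $\|x-y\|_i=0$ for all $i\in I$; $x\neq y$ iff $\|x-y\|_i>0$ for some $i\in I$. An element $x$ of $X$ is normable if its norm $\|x\|\equiv\sup\{\|x\|_i:i\in I\}$ exists, i.e. there is a real number $\|x\|$ with $\|x\|_i\le\|x\|$ for all $i$ and, for each $\varepsilon>0$, some $i$ with $\|x\|_i>\|x\|-\varepsilon$. A subset $S$ of $X$ is located (in $X$) if for each $x\in X$ and all $\alpha,\beta\in\mathbf{R}$ with $\alpha<\beta$, either for each $s\in S$ there exists $i\in I$ such that $\|x-s\|_i>\alpha$, or else there exists $s\in S$ such that $\|x-s\|_i<\beta$ for all $i\in I$. A set is finitely enumerable if it is the image of $\{1,\dots,n\}$ for some $n$, i.e. of the form $\{x_1,\dots,x_n\}$. *)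

theory Defs
  imports Complex_Main
begin

text \<open>
  In the classical logic of HOL every supremum of a bounded inhabited set of reals exists and
  every set is located, so constructive assertions about these notions would lose all content if
  they were written directly as HOL propositions.  They are therefore interpreted as in a
  Heyting-valued universe: a proposition is an element of an arbitrary complete Heyting algebra
  (frame) \<open>'h\<close>, and an assertion is valid if its value is \<open>top\<close>.  All of intuitionistic
  higher-order logic is sound for this reading.  Excluded middle fails in general, and
  dependent choice is not assumed; \<open>'h = bool\<close> gives back the classical reading.
\<close>

class frame = complete_lattice +
  assumes inf_Sup_frame: "inf a (Sup B) = Sup (inf a ` B)"

subclass (in complete_distrib_lattice) frame
  by standard (simp add: inf_Sup)

subsection \<open>Connectives and quantifiers\<close>

definition valid :: "'h::frame \<Rightarrow> bool" ("\<Turnstile> _" [4] 4)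
  where "(\<Turnstile> p) \<longleftrightarrow> p = top"

definition hconj :: "'h::frame \<Rightarrow> 'h \<Rightarrow> 'h" (infixr "\<^bold>\<and>" 35)
  where "(p \<^bold>\<and> q) = inf p q"

definition hdisj :: "'h::frame \<Rightarrow> 'h \<Rightarrow> 'h" (infixr "\<^bold>\<or>" 30)
  where "(p \<^bold>\<or> q) = sup p q"

definition himp :: "'h::frame \<Rightarrow> 'h \<Rightarrow> 'h" (infixr "\<^bold>\<longrightarrow>" 25)
  where "(p \<^bold>\<longrightarrow> q) = Sup {r. inf r p \<le> q}"

definition hiff :: "'h::frame \<Rightarrow> 'h \<Rightarrow> 'h" (infixr "\<^bold>\<longleftrightarrow>" 25)
  where "(p \<^bold>\<longleftrightarrow> q) = ((p \<^bold>\<longrightarrow> q) \<^bold>\<and> (q \<^bold>\<longrightarrow> p))"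

definition hnot :: "'h::frame \<Rightarrow> 'h" ("\<^bold>\<not> _" [40] 40)
  where "(\<^bold>\<not> p) = (p \<^bold>\<longrightarrow> bot)"

definition hall :: "('a \<Rightarrow> 'h::frame) \<Rightarrow> 'h" (binder "\<^bold>\<forall>" 8)
  where "hall P = Inf (range P)"

definition hex :: "('a \<Rightarrow> 'h::frame) \<Rightarrow> 'h" (binder "\<^bold>\<exists>" 8)
  where "hex P = Sup (range P)"

text \<open>Decidable atomic facts, used for the order of \<open>nat\<close> and \<open>rat\<close>.\<close>

definition decided :: "bool \<Rightarrow> 'h::frame" ("\<langle>_\<rangle>")
  where "\<langle>P\<rangle> = (if P then top else bot)"

lemma himp_adjoint: "r \<le> (p \<^bold>\<longrightarrow> q) \<longleftrightarrow> inf r p \<le> q"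
proof
  assume "r \<le> (p \<^bold>\<longrightarrow> q)"
  then have "inf r p \<le> inf p (Sup {r. inf r p \<le> q})"
    by (metis himp_def inf.commute inf_mono order_refl)
  also have "\<dots> \<le> q"
    by (auto simp: inf_Sup_frame inf.commute intro!: Sup_least)
  finally show "inf r p \<le> q" .
qed (simp add: himp_def Sup_upper)

lemma bool_reading:
  fixes p q :: bool and P :: "'a \<Rightarrow> bool"
  shows "(\<Turnstile> p) \<longleftrightarrow> p"
    and "(p \<^bold>\<and> q) \<longleftrightarrow> p \<and> q"
    and "(p \<^bold>\<or> q) \<longleftrightarrow> p \<or> q"
    and "(p \<^bold>\<longrightarrow> q) \<longleftrightarrow> (p \<longrightarrow> q)"
    and "(p \<^bold>\<longleftrightarrow> q) \<longleftrightarrow> (p \<longleftrightarrow> q)"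
    and "(\<^bold>\<not> p) \<longleftrightarrow> \<not> p"
    and "(\<^bold>\<forall>x. P x) \<longleftrightarrow> (\<forall>x. P x)"
    and "(\<^bold>\<exists>x. P x) \<longleftrightarrow> (\<exists>x. P x)"
    and "\<langle>p\<rangle> \<longleftrightarrow> p"
  by (auto simp: valid_def hconj_def hdisj_def himp_def hiff_def hnot_def hall_def hex_def
      decided_def)

subsection \<open>Real numbers\<close>

text \<open>
  Dedekind reals, which in the presence of countable choice are the same as Cauchy reals:
  \<open>lower x q\<close> is the value of \<open>q < x\<close> and \<open>upper x q\<close> that of \<open>x < q\<close>.  A pair of
  predicates need not be a cut with value \<open>top\<close>; quantification over the reals is quantification
  over all pairs, relativised to \<open>is_real\<close>.
\<close>

datatype 'h cut = Cut (lower: "rat \<Rightarrow> 'h") (upper: "rat \<Rightarrow> 'h")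

definition is_real :: "'h::frame cut \<Rightarrow> 'h"
  where "is_real x =
    ((\<^bold>\<exists>q. lower x q) \<^bold>\<and> (\<^bold>\<exists>q. upper x q) \<^bold>\<and>
     (\<^bold>\<forall>q. lower x q \<^bold>\<longleftrightarrow> (\<^bold>\<exists>r. \<langle>q < r\<rangle> \<^bold>\<and> lower x r)) \<^bold>\<and>
     (\<^bold>\<forall>q. upper x q \<^bold>\<longleftrightarrow> (\<^bold>\<exists>r. \<langle>r < q\<rangle> \<^bold>\<and> upper x r)) \<^bold>\<and>
     (\<^bold>\<forall>q. \<^bold>\<not> (lower x q \<^bold>\<and> upper x q)) \<^bold>\<and>
     (\<^bold>\<forall>q r. \<langle>q < r\<rangle> \<^bold>\<longrightarrow> lower x q \<^bold>\<or> upper x r))"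

definition real_less :: "'h::frame cut \<Rightarrow> 'h cut \<Rightarrow> 'h" (infix "\<^bold><" 50)
  where "(x \<^bold>< y) = (\<^bold>\<exists>q. upper x q \<^bold>\<and> lower y q)"

definition real_le :: "'h::frame cut \<Rightarrow> 'h cut \<Rightarrow> 'h" (infix "\<^bold>\<le>" 50)
  where "(x \<^bold>\<le> y) = (\<^bold>\<not> (y \<^bold>< x))"

definition real_eq :: "'h::frame cut \<Rightarrow> 'h cut \<Rightarrow> 'h" (infix "\<^bold>=" 50)
  where "(x \<^bold>= y) = (x \<^bold>\<le> y \<^bold>\<and> y \<^bold>\<le> x)"

instantiation cut :: (frame) "{zero, one, plus, uminus, minus, times, abs}"
begin

definition zero_cut :: "'a cut"
  where "0 = Cut (\<lambda>q. \<langle>q < 0\<rangle>) (\<lambda>q. \<langle>0 < q\<rangle>)"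

definition one_cut :: "'a cut"
  where "1 = Cut (\<lambda>q. \<langle>q < 1\<rangle>) (\<lambda>q. \<langle>1 < q\<rangle>)"

definition plus_cut :: "'a cut \<Rightarrow> 'a cut \<Rightarrow> 'a cut"
  where "x + y = Cut
    (\<lambda>q. \<^bold>\<exists>a b. \<langle>q < a + b\<rangle> \<^bold>\<and> lower x a \<^bold>\<and> lower y b)
    (\<lambda>q. \<^bold>\<exists>a b. \<langle>a + b < q\<rangle> \<^bold>\<and> upper x a \<^bold>\<and> upper y b)"

definition uminus_cut :: "'a cut \<Rightarrow> 'a cut"
  where "- x = Cut (\<lambda>q. upper x (- q)) (\<lambda>q. lower x (- q))"

definition minus_cut :: "'a cut \<Rightarrow> 'a cut \<Rightarrow> 'a cut"
  where "x - y = x + - (y :: 'a cut)"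

text \<open>Interval multiplication: \<open>a < x < b\<close> and \<open>c < y < d\<close> confine \<open>x y\<close> to the interval spanned by
  the four products of endpoints.\<close>

definition times_cut :: "'a cut \<Rightarrow> 'a cut \<Rightarrow> 'a cut"
  where "x * y = Cut
    (\<lambda>q. \<^bold>\<exists>a b c d. \<langle>q < Min {a * c, a * d, b * c, b * d}\<rangle> \<^bold>\<and>
       lower x a \<^bold>\<and> upper x b \<^bold>\<and> lower y c \<^bold>\<and> upper y d)
    (\<lambda>q. \<^bold>\<exists>a b c d. \<langle>Max {a * c, a * d, b * c, b * d} < q\<rangle> \<^bold>\<and>
       lower x a \<^bold>\<and> upper x b \<^bold>\<and> lower y c \<^bold>\<and> upper y d)"

definition abs_cut :: "'a cut \<Rightarrow> 'a cut"
  where "\<bar>x\<bar> = Cut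
    (\<lambda>q. lower x q \<^bold>\<or> lower (- x) q)
    (\<lambda>q. upper x q \<^bold>\<and> upper (- x) q)"

instance ..

end

subsection \<open>q-normed spaces\<close>

text \<open>
  \<open>carrier\<close>, \<open>eq\<close> and \<open>index\<close> are the values of \<open>x \<in> X\<close>, \<open>x = y\<close> and \<open>i \<in> I\<close>; \<open>eq\<close> and the operations
  are constrained only where \<open>carrier\<close> and \<open>index\<close> hold.
\<close>

record ('h, 'x, 'i) qnormed =
  carrier :: "'x \<Rightarrow> 'h"
  eq :: "'x \<Rightarrow> 'x \<Rightarrow> 'h"
  zer :: "'x"
  add :: "'x \<Rightarrow> 'x \<Rightarrow> 'x"
  neg :: "'x \<Rightarrow> 'x"
  smul :: "'h cut \<Rightarrow> 'x \<Rightarrow> 'x"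
  index :: "'i \<Rightarrow> 'h"
  qnorm :: "'i \<Rightarrow> 'x \<Rightarrow> 'h cut"

definition sub :: "('h::frame, 'x, 'i) qnormed \<Rightarrow> 'x \<Rightarrow> 'x \<Rightarrow> 'x"
  where "sub X x y = add X x (neg X y)"

definition set_with_equality :: "('h::frame, 'x, 'i) qnormed \<Rightarrow> 'h"
  where "set_with_equality X =
    ((\<^bold>\<forall>x. carrier X x \<^bold>\<longrightarrow> eq X x x) \<^bold>\<and>
     (\<^bold>\<forall>x y. carrier X x \<^bold>\<and> carrier X y \<^bold>\<and> eq X x y \<^bold>\<longrightarrow> eq X y x) \<^bold>\<and>
     (\<^bold>\<forall>x y z. carrier X x \<^bold>\<and> carrier X y \<^bold>\<and> carrier X z \<^bold>\<and> eq X x y \<^bold>\<and> eq X y z \<^bold>\<longrightarrow> eq X x z))"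

definition linear_operations :: "('h::frame, 'x, 'i) qnormed \<Rightarrow> 'h"
  where "linear_operations X =
    (carrier X (zer X) \<^bold>\<and>
     (\<^bold>\<forall>x y. carrier X x \<^bold>\<and> carrier X y \<^bold>\<longrightarrow> carrier X (add X x y)) \<^bold>\<and>
     (\<^bold>\<forall>x. carrier X x \<^bold>\<longrightarrow> carrier X (neg X x)) \<^bold>\<and>
     (\<^bold>\<forall>a x. is_real a \<^bold>\<and> carrier X x \<^bold>\<longrightarrow> carrier X (smul X a x)) \<^bold>\<and>
     (\<^bold>\<forall>x x' y y'. carrier X x \<^bold>\<and> carrier X x' \<^bold>\<and> carrier X y \<^bold>\<and> carrier X y' \<^bold>\<and>
        eq X x x' \<^bold>\<and> eq X y y' \<^bold>\<longrightarrow> eq X (add X x y) (add X x' y')) \<^bold>\<and>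
     (\<^bold>\<forall>x x'. carrier X x \<^bold>\<and> carrier X x' \<^bold>\<and> eq X x x' \<^bold>\<longrightarrow> eq X (neg X x) (neg X x')) \<^bold>\<and>
     (\<^bold>\<forall>a a' x x'. is_real a \<^bold>\<and> is_real a' \<^bold>\<and> carrier X x \<^bold>\<and> carrier X x' \<^bold>\<and>
        a \<^bold>= a' \<^bold>\<and> eq X x x' \<^bold>\<longrightarrow> eq X (smul X a x) (smul X a' x')))"

definition linear_laws :: "('h::frame, 'x, 'i) qnormed \<Rightarrow> 'h"
  where "linear_laws X =
    ((\<^bold>\<forall>x y z. carrier X x \<^bold>\<and> carrier X y \<^bold>\<and> carrier X z \<^bold>\<longrightarrow>
        eq X (add X (add X x y) z) (add X x (add X y z))) \<^bold>\<and>
     (\<^bold>\<forall>x y. carrier X x \<^bold>\<and> carrier X y \<^bold>\<longrightarrow> eq X (add X x y) (add X y x)) \<^bold>\<and>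
     (\<^bold>\<forall>x. carrier X x \<^bold>\<longrightarrow> eq X (add X x (zer X)) x) \<^bold>\<and>
     (\<^bold>\<forall>x. carrier X x \<^bold>\<longrightarrow> eq X (add X x (neg X x)) (zer X)) \<^bold>\<and>
     (\<^bold>\<forall>a x y. is_real a \<^bold>\<and> carrier X x \<^bold>\<and> carrier X y \<^bold>\<longrightarrow>
        eq X (smul X a (add X x y)) (add X (smul X a x) (smul X a y))) \<^bold>\<and>
     (\<^bold>\<forall>a b x. is_real a \<^bold>\<and> is_real b \<^bold>\<and> carrier X x \<^bold>\<longrightarrow>
        eq X (smul X (a + b) x) (add X (smul X a x) (smul X b x))) \<^bold>\<and>
     (\<^bold>\<forall>a b x. is_real a \<^bold>\<and> is_real b \<^bold>\<and> carrier X x \<^bold>\<longrightarrow>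
        eq X (smul X (a * b) x) (smul X a (smul X b x))) \<^bold>\<and>
     (\<^bold>\<forall>x. carrier X x \<^bold>\<longrightarrow> eq X (smul X 1 x) x))"

definition linear_space :: "('h::frame, 'x, 'i) qnormed \<Rightarrow> 'h"
  where "linear_space X = (set_with_equality X \<^bold>\<and> linear_operations X \<^bold>\<and> linear_laws X)"

definition seminorm :: "('h::frame, 'x, 'i) qnormed \<Rightarrow> ('x \<Rightarrow> 'h cut) \<Rightarrow> 'h"
  where "seminorm X p =
    ((\<^bold>\<forall>x. carrier X x \<^bold>\<longrightarrow> is_real (p x)) \<^bold>\<and>
     (\<^bold>\<forall>x y. carrier X x \<^bold>\<and> carrier X y \<^bold>\<and> eq X x y \<^bold>\<longrightarrow> p x \<^bold>= p y) \<^bold>\<and>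
     (\<^bold>\<forall>x. carrier X x \<^bold>\<longrightarrow> 0 \<^bold>\<le> p x) \<^bold>\<and>
     (\<^bold>\<forall>x y. carrier X x \<^bold>\<and> carrier X y \<^bold>\<longrightarrow> p (add X x y) \<^bold>\<le> p x + p y) \<^bold>\<and>
     (\<^bold>\<forall>a x. is_real a \<^bold>\<and> carrier X x \<^bold>\<longrightarrow> p (smul X a x) \<^bold>= \<bar>a\<bar> * p x))"

definition qnormed_space :: "('h::frame, 'x, 'i) qnormed \<Rightarrow> 'h"
  where "qnormed_space X =
    (linear_space X \<^bold>\<and>
     (\<^bold>\<exists>i. index X i) \<^bold>\<and>
     (\<^bold>\<forall>i. index X i \<^bold>\<longrightarrow> seminorm X (qnorm X i)) \<^bold>\<and>
     (\<^bold>\<forall>x. carrier X x \<^bold>\<longrightarrow> (\<^bold>\<exists>b c. is_real b \<^bold>\<and> is_real c \<^bold>\<and>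
        (\<^bold>\<forall>i. index X i \<^bold>\<longrightarrow> b \<^bold>\<le> qnorm X i x \<^bold>\<and> qnorm X i x \<^bold>\<le> c))) \<^bold>\<and>
     (\<^bold>\<forall>x y. carrier X x \<^bold>\<and> carrier X y \<^bold>\<longrightarrow>
        (eq X x y \<^bold>\<longleftrightarrow> (\<^bold>\<forall>i. index X i \<^bold>\<longrightarrow> qnorm X i (sub X x y) \<^bold>= 0))))"

definition normable :: "('h::frame, 'x, 'i) qnormed \<Rightarrow> 'x \<Rightarrow> 'h"
  where "normable X x =
    (\<^bold>\<exists>c. is_real c \<^bold>\<and>
       (\<^bold>\<forall>i. index X i \<^bold>\<longrightarrow> qnorm X i x \<^bold>\<le> c) \<^bold>\<and>
       (\<^bold>\<forall>\<epsilon>. is_real \<epsilon> \<^bold>\<and> 0 \<^bold>< \<epsilon> \<^bold>\<longrightarrow> (\<^bold>\<exists>i. index X i \<^bold>\<and> c - \<epsilon> \<^bold>< qnorm X i x)))"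

text \<open>A subset of \<open>X\<close> is given by the value \<open>S s\<close> of \<open>s \<in> S\<close>.\<close>

definition located :: "('h::frame, 'x, 'i) qnormed \<Rightarrow> ('x \<Rightarrow> 'h) \<Rightarrow> 'h"
  where "located X S =
    (\<^bold>\<forall>x. carrier X x \<^bold>\<longrightarrow>
      (\<^bold>\<forall>\<alpha> \<beta>. is_real \<alpha> \<^bold>\<and> is_real \<beta> \<^bold>\<and> \<alpha> \<^bold>< \<beta> \<^bold>\<longrightarrow>
        (\<^bold>\<forall>s. S s \<^bold>\<longrightarrow> (\<^bold>\<exists>i. index X i \<^bold>\<and> \<alpha> \<^bold>< qnorm X i (sub X x s))) \<^bold>\<or>
        (\<^bold>\<exists>s. S s \<^bold>\<and> (\<^bold>\<forall>i. index X i \<^bold>\<longrightarrow> qnorm X i (sub X x s) \<^bold>< \<beta>))))"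

definition singleton :: "('h::frame, 'x, 'i) qnormed \<Rightarrow> 'x \<Rightarrow> 'x \<Rightarrow> 'h"
  where "singleton X a = (\<lambda>x. carrier X x \<^bold>\<and> eq X x a)"

definition is_singleton_subset :: "('h::frame, 'x, 'i) qnormed \<Rightarrow> ('x \<Rightarrow> 'h) \<Rightarrow> 'h"
  where "is_singleton_subset X S =
    (\<^bold>\<exists>a. carrier X a \<^bold>\<and> (\<^bold>\<forall>x. S x \<^bold>\<longleftrightarrow> singleton X a x))"

text \<open>The image of \<open>{1..n}\<close> under \<open>f\<close>; the case \<open>n = 0\<close> (the empty set) is included.\<close>

definition finitely_enumerable :: "('h::frame, 'x, 'i) qnormed \<Rightarrow> ('x \<Rightarrow> 'h) \<Rightarrow> 'h"
  where "finitely_enumerable X S =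
    (\<^bold>\<exists>(n::nat) f.
       (\<^bold>\<forall>k. \<langle>1 \<le> k \<and> k \<le> n\<rangle> \<^bold>\<longrightarrow> carrier X (f k)) \<^bold>\<and>
       (\<^bold>\<forall>x. S x \<^bold>\<longleftrightarrow> carrier X x \<^bold>\<and> (\<^bold>\<exists>k. \<langle>1 \<le> k \<and> k \<le> n\<rangle> \<^bold>\<and> eq X x (f k))))"

end

theory Submission
  imports Defs
begin

text \<open>
  Propositions are forced in Kripke--Joyal style: \<open>W \<le> p\<close> says that the proposition \<open>p\<close> holds at the
  stage \<open>W\<close>, facts persist to smaller stages \<open>V \<le> W\<close>, and eliminating a disjunction or an existential statement passes to a
  smaller stage.

  If \<open>{0}\<close> is located, then the lower cut \<open>\<exists>i. q < \<parallel>x\<parallel>\<^sub>i\<close> and the upper cut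
  \<open>\<exists>r < q. \<forall>i. \<parallel>x\<parallel>\<^sub>i < r\<close> form a Dedekind real, which is the norm of \<open>x\<close>.  Conversely,
  comparing the norm of \<open>x - a\<close> with two rationals between \<open>\<alpha>\<close> and \<open>\<beta>\<close> decides the
  alternative for \<open>{a}\<close>, and finitely many such decisions combine to one for
  \<open>{x\<^sub>1, \<dots>, x\<^sub>n}\<close>.
\<close>

subsection \<open>Natural deduction in a frame\<close>

lemma inf_sup_frame: "inf a (sup b c) = sup (inf a b) (inf a (c :: 'h::frame))"
  using inf_Sup_frame[of a "{b, c}"] by simp

lemma le_valid: "(\<Turnstile> p) \<longleftrightarrow> (\<forall>W. W \<le> p)"
  unfolding valid_def by (metis top.extremum top.extremum_unique)

lemma le_hconj: "W \<le> (p \<^bold>\<and> q) \<longleftrightarrow> W \<le> p \<and> W \<le> q"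
  by (simp add: hconj_def)

lemma le_hall: "W \<le> (\<^bold>\<forall>x. P x) \<longleftrightarrow> (\<forall>x. W \<le> P x)"
  by (auto simp: hall_def le_Inf_iff)

text \<open>Among the stages below \<open>W\<close> that force \<open>p\<close> there is a largest
  one, \<open>inf W p\<close>. By adjunction the implication asks for \<open>q\<close> exactly
  there, and persistence covers the others.\<close>

lemma le_himp: "W \<le> (p \<^bold>\<longrightarrow> q) \<longleftrightarrow> (\<forall>V\<le>W. V \<le> p \<longrightarrow> V \<le> q)"
  unfolding himp_adjoint
  by (meson inf.bounded_iff inf.cobounded1 inf.cobounded2 order_trans order_refl)

lemma le_hiff: "W \<le> (p \<^bold>\<longleftrightarrow> q) \<longleftrightarrow> (\<forall>V\<le>W. V \<le> p \<longleftrightarrow> V \<le> q)"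
  unfolding hiff_def le_hconj le_himp by blast

lemmas forcing = le_hconj le_hall le_himp le_hiff

lemma le_himpD: "W \<le> (p \<^bold>\<longrightarrow> q) \<Longrightarrow> W \<le> p \<Longrightarrow> W \<le> q"
  by (auto simp: le_himp)

lemma le_decidedI: "P \<Longrightarrow> W \<le> \<langle>P\<rangle>"
  by (simp add: decided_def)

text \<open>A decided proposition is \<open>top\<close> or \<open>bot\<close>. If \<open>P\<close>
  fails, then \<open>W\<close> is \<open>bot\<close> and forces everything, so \<open>P\<close> may
  be used as an ordinary fact of HOL.\<close>

lemma le_decidedE: "W \<le> \<langle>P\<rangle> \<Longrightarrow> (P \<Longrightarrow> W \<le> r) \<Longrightarrow> W \<le> r"
  by (cases P) (auto simp: decided_def intro: order_trans)

lemma le_hdisjI1: "W \<le> p \<Longrightarrow> W \<le> (p \<^bold>\<or> q)"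
  by (simp add: hdisj_def le_supI1)

lemma le_hdisjI2: "W \<le> q \<Longrightarrow> W \<le> (p \<^bold>\<or> q)"
  by (simp add: hdisj_def le_supI2)

text \<open>Distributivity covers \<open>W\<close> by the stages \<open>inf W p\<close> and
  \<open>inf W q\<close>; what holds on both pieces holds on \<open>W\<close>.\<close>

lemma le_hdisjE:
  assumes "W \<le> (p \<^bold>\<or> q)"
    and "\<And>V. V \<le> W \<Longrightarrow> V \<le> p \<Longrightarrow> V \<le> r"
    and "\<And>V. V \<le> W \<Longrightarrow> V \<le> q \<Longrightarrow> V \<le> r"
  shows "W \<le> r"
proof -
  have "W = sup (inf W p) (inf W q)"
    using assms(1) by (simp add: hdisj_def inf_sup_frame[symmetric] inf.absorb1)
  also have "\<dots> \<le> r"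
    by (intro sup_least assms(2,3)) auto
  finally show ?thesis .
qed

lemma le_hexI: "W \<le> P x \<Longrightarrow> W \<le> (\<^bold>\<exists>x. P x)"
  unfolding hex_def by (rule order_trans[OF _ Sup_upper]) auto

text \<open>The frame law covers \<open>W\<close> by the stages \<open>inf W (P x)\<close>, one for
  each \<open>x\<close>. No single \<open>x\<close> need work at \<open>W\<close> itself, so only a
  conclusion free of the witness is brought back to \<open>W\<close>.\<close>

lemma le_hexE:
  assumes "W \<le> (\<^bold>\<exists>x. P x)" and "\<And>x V. V \<le> W \<Longrightarrow> V \<le> P x \<Longrightarrow> V \<le> r"
  shows "W \<le> r"
proof -
  have "W = Sup (inf W ` range P)"
    using assms(1) by (simp add: hex_def inf_Sup_frame[symmetric] inf.absorb1)
  also have "\<dots> \<le> r"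
    by (rule Sup_least) (auto intro!: assms(2)[OF inf_le1 inf_le2])
  finally show ?thesis .
qed

lemma le_hex_decidedE:
  assumes "W \<le> (\<^bold>\<exists>x. \<langle>P x\<rangle> \<^bold>\<and> Q x)" and "\<And>x V. V \<le> W \<Longrightarrow> P x \<Longrightarrow> V \<le> Q x \<Longrightarrow> V \<le> r"
  shows "W \<le> r"
  using assms(1) by (rule le_hexE) (auto simp: le_hconj intro: assms(2) elim!: le_decidedE)

lemma le_hex_decidedI: "P x \<Longrightarrow> W \<le> Q x \<Longrightarrow> W \<le> (\<^bold>\<exists>x. \<langle>P x\<rangle> \<^bold>\<and> Q x)"
  by (rule le_hexI[of _ _ x]) (simp add: le_hconj le_decidedI)

text \<open>Induction on \<open>K\<close>: a witness for \<open>B\<close> that has been found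
  remains one; otherwise \<open>A\<close> holds on all of \<open>K\<close>, and one further decision
  settles the new element. For infinite \<open>K\<close> such a rule would be a principle of
  omniscience.\<close>

lemma le_finite_hdisj:
  assumes "finite K" and "\<And>k. k \<in> K \<Longrightarrow> W \<le> (A k \<^bold>\<or> B k)"
  shows "W \<le> ((\<^bold>\<forall>k. \<langle>k \<in> K\<rangle> \<^bold>\<longrightarrow> A k) \<^bold>\<or> (\<^bold>\<exists>k. \<langle>k \<in> K\<rangle> \<^bold>\<and> B k))"
  using assms
proof (induction K)
  case empty
  show ?case
    by (rule le_hdisjI1) (auto simp: le_hall le_himp elim: le_decidedE)
next
  case (insert k K)
  have *: "W \<le> (A k \<^bold>\<or> B k)" using insert.prems by simp
  have "W \<le> ((\<^bold>\<forall>k. \<langle>k \<in> K\<rangle> \<^bold>\<longrightarrow> A k) \<^bold>\<or> (\<^bold>\<exists>k. \<langle>k \<in> K\<rangle> \<^bold>\<and> B k))"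
    using insert by simp
  then show ?case
  proof (rule le_hdisjE)
    fix V assume V: "V \<le> W" "V \<le> (\<^bold>\<forall>k. \<langle>k \<in> K\<rangle> \<^bold>\<longrightarrow> A k)"
    have all: "U \<le> A j" if "U \<le> V" "j \<in> K" for U j
      using V(2) that by (auto simp: forcing le_decidedI)
    show "V \<le> ((\<^bold>\<forall>j. \<langle>j \<in> insert k K\<rangle> \<^bold>\<longrightarrow> A j) \<^bold>\<or> (\<^bold>\<exists>j. \<langle>j \<in> insert k K\<rangle> \<^bold>\<and> B j))"
      using order_trans[OF V(1) *]
    proof (rule le_hdisjE)
      fix U assume U: "U \<le> V" "U \<le> A k"
      have "U \<le> (\<^bold>\<forall>j. \<langle>j \<in> insert k K\<rangle> \<^bold>\<longrightarrow> A j)"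
        using U by (auto simp: forcing elim!: le_decidedE intro: all order_trans)
      then show "U \<le> ((\<^bold>\<forall>j. \<langle>j \<in> insert k K\<rangle> \<^bold>\<longrightarrow> A j) \<^bold>\<or> (\<^bold>\<exists>j. \<langle>j \<in> insert k K\<rangle> \<^bold>\<and> B j))"
        by (rule le_hdisjI1)
    next
      fix U assume "U \<le> V" "U \<le> B k"
      then show "U \<le> ((\<^bold>\<forall>j. \<langle>j \<in> insert k K\<rangle> \<^bold>\<longrightarrow> A j) \<^bold>\<or> (\<^bold>\<exists>j. \<langle>j \<in> insert k K\<rangle> \<^bold>\<and> B j))"
        by (intro le_hdisjI2 le_hex_decidedI[where x = k]) auto
    qed
  next
    fix V assume "V \<le> W" "V \<le> (\<^bold>\<exists>j. \<langle>j \<in> K\<rangle> \<^bold>\<and> B j)"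
    from this(2) show "V \<le> ((\<^bold>\<forall>j. \<langle>j \<in> insert k K\<rangle> \<^bold>\<longrightarrow> A j) \<^bold>\<or> (\<^bold>\<exists>j. \<langle>j \<in> insert k K\<rangle> \<^bold>\<and> B j))"
    proof (rule le_hex_decidedE)
      fix j U assume "j \<in> K" "U \<le> B j"
      then show "U \<le> ((\<^bold>\<forall>j. \<langle>j \<in> insert k K\<rangle> \<^bold>\<longrightarrow> A j) \<^bold>\<or> (\<^bold>\<exists>j. \<langle>j \<in> insert k K\<rangle> \<^bold>\<and> B j))"
        by (intro le_hdisjI2 le_hex_decidedI[where x = j]) auto
    qed
  qed
qed

subsection \<open>Dedekind reals\<close>

text \<open>Each equivalence in \<open>is_real\<close> is split into openness and monotonicity.
  Conditions with a forced premise are implications and must be checked at all smaller stages;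
  inhabitedness and locatedness are asked at \<open>W\<close> and persist by themselves.\<close>

lemma is_realI:
  assumes "W \<le> (\<^bold>\<exists>q. lower x q)" and "W \<le> (\<^bold>\<exists>q. upper x q)"
    and "\<And>V q. V \<le> W \<Longrightarrow> V \<le> lower x q \<Longrightarrow> V \<le> (\<^bold>\<exists>r. \<langle>q < r\<rangle> \<^bold>\<and> lower x r)"
    and "\<And>V q r. V \<le> W \<Longrightarrow> q < r \<Longrightarrow> V \<le> lower x r \<Longrightarrow> V \<le> lower x q"
    and "\<And>V q. V \<le> W \<Longrightarrow> V \<le> upper x q \<Longrightarrow> V \<le> (\<^bold>\<exists>r. \<langle>r < q\<rangle> \<^bold>\<and> upper x r)"
    and "\<And>V q r. V \<le> W \<Longrightarrow> r < q \<Longrightarrow> V \<le> upper x r \<Longrightarrow> V \<le> upper x q"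
    and "\<And>V q. V \<le> W \<Longrightarrow> V \<le> lower x q \<Longrightarrow> V \<le> upper x q \<Longrightarrow> V \<le> bot"
    and "\<And>q r. q < r \<Longrightarrow> W \<le> (lower x q \<^bold>\<or> upper x r)"
  shows "W \<le> is_real x"
proof -
  have "V \<le> lower x q" if "V \<le> W" "V \<le> (\<^bold>\<exists>r. \<langle>q < r\<rangle> \<^bold>\<and> lower x r)" for V q
    using that(2) by (rule le_hex_decidedE) (blast intro: assms(4) order_trans that(1))
  moreover have "V \<le> upper x q" if "V \<le> W" "V \<le> (\<^bold>\<exists>r. \<langle>r < q\<rangle> \<^bold>\<and> upper x r)" for V q
    using that(2) by (rule le_hex_decidedE) (blast intro: assms(6) order_trans that(1))
  moreover have "V \<le> (lower x q \<^bold>\<or> upper x r)" if "V \<le> W" "V \<le> \<langle>q < r\<rangle>" for V q r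
    using that(2) by (rule le_decidedE) (blast intro: assms(8) order_trans that(1))
  ultimately show ?thesis
    unfolding is_real_def hnot_def le_hconj le_hall
    by (intro conjI allI assms(1,2) le_hiff[THEN iffD2] le_himp[THEN iffD2] impI iffI)
      (assumption | rule assms(3,5) | drule le_hconj[THEN iffD1], erule conjE, rule assms(7))+
qed

lemma is_realD:
  assumes "W \<le> is_real x"
  shows real_lower_ex: "W \<le> (\<^bold>\<exists>q. lower x q)"
    and real_upper_ex: "W \<le> (\<^bold>\<exists>q. upper x q)"
    and real_lower_open: "W \<le> lower x q \<Longrightarrow> W \<le> (\<^bold>\<exists>r. \<langle>q < r\<rangle> \<^bold>\<and> lower x r)"
    and real_lower_mono: "q < r \<Longrightarrow> W \<le> lower x r \<Longrightarrow> W \<le> lower x q"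
    and real_upper_open: "W \<le> upper x q \<Longrightarrow> W \<le> (\<^bold>\<exists>r. \<langle>r < q\<rangle> \<^bold>\<and> upper x r)"
    and real_upper_mono: "r < q \<Longrightarrow> W \<le> upper x r \<Longrightarrow> W \<le> upper x q"
    and real_disjoint: "W \<le> lower x q \<Longrightarrow> W \<le> upper x q \<Longrightarrow> W \<le> p"
    and real_located: "q < r \<Longrightarrow> W \<le> (lower x q \<^bold>\<or> upper x r)"
proof -
  note * = assms[unfolded is_real_def hnot_def le_hconj le_hall]
  show "W \<le> (\<^bold>\<exists>q. lower x q)" "W \<le> (\<^bold>\<exists>q. upper x q)" using * by auto
  have l: "W \<le> lower x q \<longleftrightarrow> W \<le> (\<^bold>\<exists>r. \<langle>q < r\<rangle> \<^bold>\<and> lower x r)" for q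
    using * le_hiff[of W] by auto
  have u: "W \<le> upper x q \<longleftrightarrow> W \<le> (\<^bold>\<exists>r. \<langle>r < q\<rangle> \<^bold>\<and> upper x r)" for q
    using * le_hiff[of W] by auto
  show "W \<le> lower x q \<Longrightarrow> W \<le> (\<^bold>\<exists>r. \<langle>q < r\<rangle> \<^bold>\<and> lower x r)"
    "W \<le> upper x q \<Longrightarrow> W \<le> (\<^bold>\<exists>r. \<langle>r < q\<rangle> \<^bold>\<and> upper x r)"
    using l u by auto
  show "q < r \<Longrightarrow> W \<le> lower x r \<Longrightarrow> W \<le> lower x q"
    unfolding l[of q] by (rule le_hex_decidedI)
  show "r < q \<Longrightarrow> W \<le> upper x r \<Longrightarrow> W \<le> upper x q"
    unfolding u[of q] by (rule le_hex_decidedI)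
  show "W \<le> p" if "W \<le> lower x q" "W \<le> upper x q"
  proof -
    have "W \<le> (lower x q \<^bold>\<and> upper x q \<^bold>\<longrightarrow> bot)" using * by blast
    then have "W \<le> bot" by (rule le_himpD) (simp add: le_hconj that)
    then show ?thesis by (rule order_trans) simp
  qed
  show "q < r \<Longrightarrow> W \<le> (lower x q \<^bold>\<or> upper x r)"
    using * by (blast intro: le_himpD le_decidedI)
qed

text \<open>If \<open>r \<le> q\<close>, monotonicity moves \<open>r\<close> into the lower cut,
  against disjointness. This is an elimination rule because at the stage \<open>bot\<close> the cut
  premises hold for all \<open>q\<close> and \<open>r\<close>, so \<open>q < r\<close> is available
  only towards a goal at \<open>W\<close>.\<close>

lemma real_lower_less_upper:
  assumes "W \<le> is_real x" "W \<le> lower x q" "W \<le> upper x r" "q < r \<Longrightarrow> W \<le> p"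
  shows "W \<le> p"
proof (cases "q < r")
  case False
  then have "W \<le> lower x r"
    using assms(2) real_lower_mono[OF assms(1), of r q] by (cases "q = r") auto
  then show ?thesis using real_disjoint[OF assms(1)] assms(3) by blast
qed (use assms(4) in blast)

text \<open>A bracket of length at most \<open>n d\<close> with \<open>d = e/4\<close> is either already short enough or
  shrinks by \<open>d\<close>.\<close>

lemma real_approx:
  assumes "W \<le> is_real x" "e > 0"
  shows "W \<le> (\<^bold>\<exists>q r. \<langle>r - q < e\<rangle> \<^bold>\<and> lower x q \<^bold>\<and> upper x r)" (is "W \<le> ?goal")
proof -
  have short: "V \<le> ?goal" if "r - q < e" "V \<le> lower x q" "V \<le> upper x r" for V q r
    using that by (intro le_hexI[of _ _ q] le_hexI[of _ _ r]) (simp add: forcing le_decidedI)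
  have *: "V \<le> ?goal"
    if "V \<le> W" "V \<le> lower x q" "V \<le> upper x r" "r - q \<le> of_nat n * (e / 4)" for V q r n
    using that
  proof (induction n arbitrary: V q)
    case 0
    then show ?case using assms(2) by (intro short[of r q]) auto
  next
    case (Suc n)
    have "V \<le> (lower x (q + e / 4) \<^bold>\<or> upper x (q + e / 2))"
      using assms(2) by (intro real_located order_trans[OF Suc.prems(1) assms(1)]) simp
    then show ?case
    proof (rule le_hdisjE)
      fix U assume "U \<le> V" "U \<le> lower x (q + e / 4)"
      then show "U \<le> ?goal"
        using Suc.prems by (intro Suc.IH[of U "q + e / 4"]) (auto simp: algebra_simps)
    next
      fix U assume "U \<le> V" "U \<le> upper x (q + e / 2)"
      then show "U \<le> ?goal"
        using Suc.prems assms(2) by (intro short[of "q + e / 2" q]) auto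
    qed
  qed
  show ?thesis
    using real_lower_ex[OF assms(1)]
  proof (rule le_hexE)
    fix q V assume V: "V \<le> W" "V \<le> lower x q"
    show "V \<le> ?goal"
      using order_trans[OF V(1) real_upper_ex[OF assms(1)]]
    proof (rule le_hexE)
      fix r U assume U: "U \<le> V" "U \<le> upper x r"
      \<comment> \<open>The Archimedean property bounds the first bracket by finitely many steps of
        length \<open>e / 4\<close>.\<close>
      obtain n where "(r - q) / (e / 4) \<le> of_nat n" using real_arch_simple by blast
      then have "r - q \<le> of_nat n * (e / 4)" using assms(2) by (simp add: field_simps)
      then show "U \<le> ?goal" using U V by (intro *[of U q r n]) auto
    qed
  qed
qed

section \<open>The order of the reals\<close>

lemma real_lessI: "W \<le> upper x q \<Longrightarrow> W \<le> lower y q \<Longrightarrow> W \<le> (x \<^bold>< y)"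
  unfolding real_less_def by (rule le_hexI[of _ _ q]) (simp add: le_hconj)

lemma real_lessE:
  assumes "W \<le> (x \<^bold>< y)" "\<And>V q. V \<le> W \<Longrightarrow> V \<le> upper x q \<Longrightarrow> V \<le> lower y q \<Longrightarrow> V \<le> p"
  shows "W \<le> p"
  using assms(1) unfolding real_less_def by (rule le_hexE) (auto simp: le_hconj intro: assms(2))

lemma real_leI:
  assumes "\<And>V q. V \<le> W \<Longrightarrow> V \<le> lower x q \<Longrightarrow> V \<le> upper y q \<Longrightarrow> V \<le> bot"
  shows "W \<le> (x \<^bold>\<le> y)"
  unfolding real_le_def hnot_def le_himp
proof (intro allI impI)
  fix V assume "V \<le> W" "V \<le> (y \<^bold>< x)"
  from this(2) show "V \<le> bot"
    by (rule real_lessE) (blast intro: assms order_trans \<open>V \<le> W\<close>)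
qed

lemma real_leD:
  assumes "W \<le> (x \<^bold>\<le> y)" "W \<le> lower x q" "W \<le> upper y q"
  shows "W \<le> p"
proof -
  have "W \<le> bot"
    using le_himpD[OF assms(1)[unfolded real_le_def hnot_def] real_lessI[OF assms(3,2)]] .
  then show ?thesis by (rule order_trans) simp
qed

text \<open>The weak order is a negation and gives no positive information by itself. That comes
  from locatedness of \<open>x\<close>: for \<open>r < q\<close> with \<open>y < r\<close>, either
  \<open>r < x\<close>, which is refuted, or \<open>x < q\<close>.\<close>

lemma real_le_upper:
  assumes "W \<le> is_real x" "W \<le> is_real y" "W \<le> (x \<^bold>\<le> y)" "W \<le> upper y q"
  shows "W \<le> upper x q"
  using real_upper_open[OF assms(2,4)]
proof (rule le_hex_decidedE)
  fix r V assume V: "V \<le> W" "r < q" "V \<le> upper y r"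
  show "V \<le> upper x q"
    using order_trans[OF V(1) real_located[OF assms(1) V(2)]]
    by (rule le_hdisjE) (meson real_leD order_trans V(1,3) assms(3))+
qed

lemma real_le_lower:
  assumes "W \<le> is_real x" "W \<le> is_real y" "W \<le> (x \<^bold>\<le> y)" "W \<le> lower x q"
  shows "W \<le> lower y q"
  using real_lower_open[OF assms(1,4)]
proof (rule le_hex_decidedE)
  fix r V assume V: "V \<le> W" "q < r" "V \<le> lower x r"
  show "V \<le> lower y q"
    using order_trans[OF V(1) real_located[OF assms(2) V(2)]]
    by (rule le_hdisjE) (meson real_leD order_trans V(1,3) assms(3))+
qed

section \<open>Rational constants and differences of reals\<close>

definition rat_cut :: "rat \<Rightarrow> 'h::frame cut"
  where "rat_cut a = Cut (\<lambda>q. \<langle>q < a\<rangle>) (\<lambda>q. \<langle>a < q\<rangle>)"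

lemma lower_rat_cut: "lower (rat_cut a) q = \<langle>q < a\<rangle>"
  and upper_rat_cut: "upper (rat_cut a) q = \<langle>a < q\<rangle>"
  by (simp_all add: rat_cut_def)

lemma zero_cut_eq: "0 = rat_cut 0"
  by (simp add: zero_cut_def rat_cut_def)

lemma real_rat_cut: "W \<le> is_real (rat_cut a)"
proof (rule is_realI, unfold lower_rat_cut upper_rat_cut)
  show "W \<le> (\<^bold>\<exists>q. \<langle>q < a\<rangle>)"
    by (rule le_hexI[of _ _ "a - 1"]) (simp add: le_decidedI)
  show "W \<le> (\<^bold>\<exists>q. \<langle>a < q\<rangle>)"
    by (rule le_hexI[of _ _ "a + 1"]) (simp add: le_decidedI)
next
  fix V :: 'a and q assume "V \<le> \<langle>q < a\<rangle>"
  then show "V \<le> (\<^bold>\<exists>r. \<langle>q < r\<rangle> \<^bold>\<and> \<langle>r < a\<rangle>)"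
    by (rule le_decidedE)
      (drule dense, elim exE conjE, rule le_hex_decidedI, assumption, erule le_decidedI)
next
  fix V :: 'a and q assume "V \<le> \<langle>a < q\<rangle>"
  then show "V \<le> (\<^bold>\<exists>r. \<langle>r < q\<rangle> \<^bold>\<and> \<langle>a < r\<rangle>)"
    by (rule le_decidedE)
      (drule dense, elim exE conjE, rule le_hex_decidedI, assumption, erule le_decidedI)
next
  fix q r :: rat assume "q < r"
  then show "W \<le> (\<langle>q < a\<rangle> \<^bold>\<or> \<langle>a < r\<rangle>)"
    by (cases "q < a") (auto intro: le_hdisjI1 le_hdisjI2 le_decidedI)
qed (auto elim!: le_decidedE intro: le_decidedI)

text \<open>Openness of the lower cut supplies the rational strictly between \<open>a\<close> and
  \<open>y\<close> that \<open>real_less\<close> requires; monotonicity gives the converse.\<close>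

lemma rat_cut_less_iff:
  assumes "W \<le> is_real y"
  shows "W \<le> (rat_cut a \<^bold>< y) \<longleftrightarrow> W \<le> lower y a"
proof
  assume "W \<le> (rat_cut a \<^bold>< y)"
  then show "W \<le> lower y a"
    by (rule real_lessE)
      (auto simp: upper_rat_cut elim!: le_decidedE intro: real_lower_mono order_trans[OF _ assms])
next
  assume "W \<le> lower y a"
  then show "W \<le> (rat_cut a \<^bold>< y)"
    by (rule real_lower_open[OF assms, THEN le_hex_decidedE])
      (auto simp: upper_rat_cut intro!: real_lessI le_decidedI)
qed

lemma less_rat_cut_iff:
  assumes "W \<le> is_real y"
  shows "W \<le> (y \<^bold>< rat_cut a) \<longleftrightarrow> W \<le> upper y a"
proof
  assume "W \<le> (y \<^bold>< rat_cut a)"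
  then show "W \<le> upper y a"
    by (rule real_lessE)
      (auto simp: lower_rat_cut elim!: le_decidedE intro: real_upper_mono order_trans[OF _ assms])
next
  assume "W \<le> upper y a"
  then show "W \<le> (y \<^bold>< rat_cut a)"
    by (rule real_upper_open[OF assms, THEN le_hex_decidedE])
      (auto simp: lower_rat_cut intro!: real_lessI le_decidedI)
qed

lemma upper_minus_cutI:
  assumes "W \<le> upper x a" "W \<le> lower y b" "a - b < q"
  shows "W \<le> upper (x - y) q"
  unfolding minus_cut_def plus_cut_def uminus_cut_def cut.sel
  \<comment> \<open>Subtraction adds \<open>- y\<close>, whose upper cut at \<open>- b\<close> is
    \<open>lower y b\<close>; hence the witness \<open>- b\<close>.\<close>
  by (rule le_hexI[of _ _ a], rule le_hexI[of _ _ "- b"]) (use assms in \<open>simp add: forcing le_decidedI\<close>)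

lemma upper_minus_cutE:
  assumes "W \<le> upper (x - y) q"
    and "\<And>V a b. V \<le> W \<Longrightarrow> a - b < q \<Longrightarrow> V \<le> upper x a \<Longrightarrow> V \<le> lower y b \<Longrightarrow> V \<le> p"
  shows "W \<le> p"
  using assms(1) unfolding minus_cut_def plus_cut_def uminus_cut_def cut.sel
proof (rule le_hexE)
  fix a V
  assume "V \<le> W" "V \<le> (\<^bold>\<exists>b. \<langle>a + b < q\<rangle> \<^bold>\<and> upper x a \<^bold>\<and> lower y (- b))"
  from this(2) show "V \<le> p"
  proof (rule le_hex_decidedE)
    fix b U assume "U \<le> V" "a + b < q" "U \<le> (upper x a \<^bold>\<and> lower y (- b))"
    then show "U \<le> p"
      using \<open>V \<le> W\<close> by (intro assms(2)[of U a "- b"]) (auto simp: le_hconj)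
  qed
qed

subsection \<open>Located sets and normable elements\<close>

lemma qnormed_spaceD:
  assumes "W \<le> qnormed_space X"
  shows qnormed_zer: "W \<le> carrier X (zer X)"
    and qnormed_sub: "W \<le> carrier X x \<Longrightarrow> W \<le> carrier X y \<Longrightarrow> W \<le> carrier X (sub X x y)"
    and qnormed_eq_refl: "W \<le> carrier X x \<Longrightarrow> W \<le> eq X x x"
    and qnormed_eq_sym: "W \<le> carrier X x \<Longrightarrow> W \<le> carrier X y \<Longrightarrow> W \<le> eq X x y \<Longrightarrow>
      W \<le> eq X y x"
    and qnormed_sub_cong: "W \<le> carrier X x \<Longrightarrow> W \<le> carrier X y \<Longrightarrow> W \<le> carrier X z \<Longrightarrow>
      W \<le> eq X y z \<Longrightarrow> W \<le> eq X (sub X x y) (sub X x z)"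
    and qnormed_sub_zer: "W \<le> carrier X x \<Longrightarrow> W \<le> eq X (sub X x (zer X)) x"
    and qnormed_index_ex: "W \<le> (\<^bold>\<exists>i. index X i)"
    and qnormed_seminorm: "W \<le> index X i \<Longrightarrow> W \<le> seminorm X (qnorm X i)"
    and qnormed_bounded: "W \<le> carrier X x \<Longrightarrow> W \<le> (\<^bold>\<exists>b c. is_real b \<^bold>\<and> is_real c \<^bold>\<and>
        (\<^bold>\<forall>i. index X i \<^bold>\<longrightarrow> b \<^bold>\<le> qnorm X i x \<^bold>\<and> qnorm X i x \<^bold>\<le> c))"
proof -
  have "W \<le> set_with_equality X" "W \<le> linear_operations X" "W \<le> linear_laws X"
    using assms by (simp_all add: qnormed_space_def linear_space_def le_hconj)
  note eqs = this(1)[unfolded set_with_equality_def le_hconj le_hall]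
    and ops = this(2)[unfolded linear_operations_def le_hconj le_hall]
    and laws = this(3)[unfolded linear_laws_def le_hconj le_hall]
    and Q = assms[unfolded qnormed_space_def le_hconj le_hall]
  show zer: "W \<le> carrier X (zer X)" using ops by blast
  have neg: "W \<le> carrier X (neg X x)" if "W \<le> carrier X x" for x
    by (rule le_himpD[of _ "carrier X x"]) (use ops that in auto)
  have add: "W \<le> carrier X (add X x y)" if "W \<le> carrier X x" "W \<le> carrier X y" for x y
    by (rule le_himpD[of _ "carrier X x \<^bold>\<and> carrier X y"]) (use ops that in \<open>auto simp: le_hconj\<close>)
  show sub: "W \<le> carrier X x \<Longrightarrow> W \<le> carrier X y \<Longrightarrow> W \<le> carrier X (sub X x y)" for x y
    unfolding sub_def by (intro add neg)
  show refl: "W \<le> eq X x x" if "W \<le> carrier X x" for x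
    by (rule le_himpD[of _ "carrier X x"]) (use eqs that in auto)
  show sym: "W \<le> eq X y x" if "W \<le> carrier X x" "W \<le> carrier X y" "W \<le> eq X x y" for x y
    by (rule le_himpD[of _ "carrier X x \<^bold>\<and> carrier X y \<^bold>\<and> eq X x y"])
      (use eqs that in \<open>auto simp: le_hconj\<close>)
  have trans: "W \<le> eq X x z" if "W \<le> carrier X x" "W \<le> carrier X y" "W \<le> carrier X z"
    "W \<le> eq X x y" "W \<le> eq X y z" for x y z
    by (rule le_himpD[of _ "carrier X x \<^bold>\<and> carrier X y \<^bold>\<and> carrier X z \<^bold>\<and> eq X x y \<^bold>\<and> eq X y z"])
      (use eqs that in \<open>auto simp: le_hconj\<close>)
  have neg_cong: "W \<le> eq X (neg X x) (neg X y)"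
    if "W \<le> carrier X x" "W \<le> carrier X y" "W \<le> eq X x y" for x y
    by (rule le_himpD[of _ "carrier X x \<^bold>\<and> carrier X y \<^bold>\<and> eq X x y"])
      (use ops that in \<open>auto simp: le_hconj\<close>)
  have add_cong: "W \<le> eq X (add X x y) (add X x z)"
    if "W \<le> carrier X x" "W \<le> carrier X y" "W \<le> carrier X z" "W \<le> eq X y z" for x y z
    by (rule le_himpD[of _ "carrier X x \<^bold>\<and> carrier X x \<^bold>\<and> carrier X y \<^bold>\<and> carrier X z \<^bold>\<and>
          eq X x x \<^bold>\<and> eq X y z"])
      (use ops refl that in \<open>auto simp: le_hconj\<close>)
  show "W \<le> eq X (sub X x y) (sub X x z)"
    if "W \<le> carrier X x" "W \<le> carrier X y" "W \<le> carrier X z" "W \<le> eq X y z" for y z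
    unfolding sub_def using that by (intro add_cong neg_cong neg)
  have add_zer: "W \<le> eq X (add X x (zer X)) x" if "W \<le> carrier X x" for x
    by (rule le_himpD[of _ "carrier X x"]) (use laws that in auto)
  have comm: "W \<le> eq X (add X x y) (add X y x)" if "W \<le> carrier X x" "W \<le> carrier X y" for x y
    by (rule le_himpD[of _ "carrier X x \<^bold>\<and> carrier X y"]) (use laws that in \<open>auto simp: le_hconj\<close>)
  have right_inv: "W \<le> eq X (add X x (neg X x)) (zer X)" if "W \<le> carrier X x" for x
    by (rule le_himpD[of _ "carrier X x"]) (use laws that in auto)
  \<comment> \<open>That subtracting zero changes nothing rests on -0 = 0, which follows from -0 =
    -0 + 0 = 0 + (-0) = 0.\<close>
  let ?n = "neg X (zer X)"
  have n: "W \<le> carrier X ?n" by (intro neg zer)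
  have "W \<le> eq X (add X ?n (zer X)) (zer X)"
    by (rule trans[OF _ _ _ comm right_inv]) (intro add n zer)+
  then have "W \<le> eq X ?n (zer X)"
    by (rule trans[OF _ _ _ sym[OF _ _ add_zer], rotated -1]) (intro add n zer)+
  then show "W \<le> eq X (sub X x (zer X)) x" if "W \<le> carrier X x"
    unfolding sub_def by (intro trans[OF _ _ _ add_cong add_zer] add that n zer)
  show "W \<le> (\<^bold>\<exists>i. index X i)" using Q by blast
  show "W \<le> seminorm X (qnorm X i)" if "W \<le> index X i"
    by (rule le_himpD[of _ "index X i"]) (use Q that in auto)
  show "W \<le> (\<^bold>\<exists>b c. is_real b \<^bold>\<and> is_real c \<^bold>\<and>
        (\<^bold>\<forall>i. index X i \<^bold>\<longrightarrow> b \<^bold>\<le> qnorm X i x \<^bold>\<and> qnorm X i x \<^bold>\<le> c))" if "W \<le> carrier X x"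
    by (rule le_himpD[of _ "carrier X x"]) (use Q that in auto)
qed

lemma qnorm_real:
  assumes "W \<le> qnormed_space X" "W \<le> index X i" "W \<le> carrier X x"
  shows "W \<le> is_real (qnorm X i x)"
  by (rule le_himpD[of _ "carrier X x"])
    (use qnormed_seminorm[OF assms(1,2)] assms(3) in \<open>simp_all add: seminorm_def le_hconj le_hall\<close>)

text \<open>\<open>seminorm\<close> yields equality of the two values only as a pair of negated
  inequalities; since both values are reals, these become inclusions of cuts in both
  directions.\<close>

lemma qnorm_cong:
  assumes "W \<le> qnormed_space X" "W \<le> index X i" "W \<le> carrier X x" "W \<le> carrier X y"
    "W \<le> eq X x y"
  shows lower_qnorm_cong: "W \<le> lower (qnorm X i x) q \<longleftrightarrow> W \<le> lower (qnorm X i y) q"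
    and upper_qnorm_cong: "W \<le> upper (qnorm X i x) q \<longleftrightarrow> W \<le> upper (qnorm X i y) q"
proof -
  have "W \<le> (qnorm X i x \<^bold>= qnorm X i y)"
    by (rule le_himpD[of _ "carrier X x \<^bold>\<and> carrier X y \<^bold>\<and> eq X x y"])
      (use qnormed_seminorm[OF assms(1,2)] assms(3-) in \<open>simp_all add: seminorm_def le_hconj le_hall\<close>)
  then have "W \<le> (qnorm X i x \<^bold>\<le> qnorm X i y)" "W \<le> (qnorm X i y \<^bold>\<le> qnorm X i x)"
    by (simp_all add: real_eq_def le_hconj)
  moreover have "W \<le> is_real (qnorm X i x)" "W \<le> is_real (qnorm X i y)"
    using assms by (simp_all add: qnorm_real)
  ultimately show "W \<le> lower (qnorm X i x) q \<longleftrightarrow> W \<le> lower (qnorm X i y) q"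
    "W \<le> upper (qnorm X i x) q \<longleftrightarrow> W \<le> upper (qnorm X i y) q"
    by (meson real_le_lower real_le_upper)+
qed

text \<open>Needed because \<open>singleton X a\<close> contains every element equal to
  \<open>a\<close>, so that distances have to be moved from one representative to another.\<close>

lemma qnorm_sub_less_cong:
  assumes "W \<le> qnormed_space X" "W \<le> index X i" "W \<le> carrier X x" "W \<le> carrier X y"
    "W \<le> carrier X z" "W \<le> eq X y z"
  shows "W \<le> (\<alpha> \<^bold>< qnorm X i (sub X x z)) \<Longrightarrow> W \<le> (\<alpha> \<^bold>< qnorm X i (sub X x y))"
    and "W \<le> (qnorm X i (sub X x z) \<^bold>< \<beta>) \<Longrightarrow> W \<le> (qnorm X i (sub X x y) \<^bold>< \<beta>)"
proof -
  have *: "V \<le> lower (qnorm X i (sub X x y)) q \<longleftrightarrow> V \<le> lower (qnorm X i (sub X x z)) q"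
    "V \<le> upper (qnorm X i (sub X x y)) q \<longleftrightarrow> V \<le> upper (qnorm X i (sub X x z)) q"
    if "V \<le> W" for V q
    using assms[THEN order_trans[OF that]]
    by (simp_all add: qnormed_sub qnormed_sub_cong lower_qnorm_cong[of V X i "sub X x y" "sub X x z"]
        upper_qnorm_cong[of V X i "sub X x y" "sub X x z"])
  show "W \<le> (\<alpha> \<^bold>< qnorm X i (sub X x z)) \<Longrightarrow> W \<le> (\<alpha> \<^bold>< qnorm X i (sub X x y))"
    by (erule real_lessE) (auto simp: * intro: real_lessI)
  show "W \<le> (qnorm X i (sub X x z) \<^bold>< \<beta>) \<Longrightarrow> W \<le> (qnorm X i (sub X x y) \<^bold>< \<beta>)"
    by (erule real_lessE) (auto simp: * intro: real_lessI)
qed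

section \<open>The two alternatives of locatedness, and their form for singletons\<close>

abbreviation far :: "('h::frame, 'x, 'i) qnormed \<Rightarrow> ('x \<Rightarrow> 'h) \<Rightarrow> 'x \<Rightarrow> 'h cut \<Rightarrow> 'h"
  where "far X S x \<alpha> \<equiv>
    (\<^bold>\<forall>s. S s \<^bold>\<longrightarrow> (\<^bold>\<exists>i. index X i \<^bold>\<and> \<alpha> \<^bold>< qnorm X i (sub X x s)))"

abbreviation near :: "('h::frame, 'x, 'i) qnormed \<Rightarrow> ('x \<Rightarrow> 'h) \<Rightarrow> 'x \<Rightarrow> 'h cut \<Rightarrow> 'h"
  where "near X S x \<beta> \<equiv>
    (\<^bold>\<exists>s. S s \<^bold>\<and> (\<^bold>\<forall>i. index X i \<^bold>\<longrightarrow> qnorm X i (sub X x s) \<^bold>< \<beta>))"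

lemma locatedI:
  assumes "\<And>V x \<alpha> \<beta>. V \<le> W \<Longrightarrow> V \<le> carrier X x \<Longrightarrow> V \<le> is_real \<alpha> \<Longrightarrow> V \<le> is_real \<beta> \<Longrightarrow>
    V \<le> (\<alpha> \<^bold>< \<beta>) \<Longrightarrow> V \<le> (far X S x \<alpha> \<^bold>\<or> near X S x \<beta>)"
  shows "W \<le> located X S"
  unfolding located_def forcing by (blast intro: assms order_trans)

lemma locatedD:
  assumes "W \<le> located X S" "W \<le> carrier X x" "W \<le> is_real \<alpha>" "W \<le> is_real \<beta>" "W \<le> (\<alpha> \<^bold>< \<beta>)"
  shows "W \<le> (far X S x \<alpha> \<^bold>\<or> near X S x \<beta>)"
  using assms(1)[unfolded located_def le_hall, rule_format, of x, THEN le_himpD, OF assms(2)]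
  unfolding le_hall using assms(3-) by (blast intro: le_himpD le_hconj[THEN iffD2])

text \<open>A singleton subset is given only up to equivalence of membership with some
  \<open>singleton X a\<close>. Such an equivalence holds at every smaller stage, so both
  alternatives transfer.\<close>

lemma located_cong:
  assumes "W \<le> (\<^bold>\<forall>x. S x \<^bold>\<longleftrightarrow> T x)" "W \<le> located X T"
  shows "W \<le> located X S"
proof (rule locatedI)
  fix V x \<alpha> \<beta>
  assume V: "V \<le> W" "V \<le> carrier X x" "V \<le> is_real \<alpha>" "V \<le> is_real \<beta>" "V \<le> (\<alpha> \<^bold>< \<beta>)"
  have ST: "U \<le> S s \<longleftrightarrow> U \<le> T s" if "U \<le> V" for U s
    using assms(1) order_trans[OF that V(1)] unfolding forcing by blast
  show "V \<le> (far X S x \<alpha> \<^bold>\<or> near X S x \<beta>)"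
    using locatedD[OF order_trans[OF V(1) assms(2)] V(2-)]
  proof (rule le_hdisjE)
    fix U assume "U \<le> V" "U \<le> far X T x \<alpha>"
    then have "U \<le> far X S x \<alpha>"
      using ST by (auto simp: forcing intro: order_trans)
    then show "U \<le> (far X S x \<alpha> \<^bold>\<or> near X S x \<beta>)" by (rule le_hdisjI1)
  next
    fix U assume U: "U \<le> V" "U \<le> near X T x \<beta>"
    from U(2) have "U \<le> near X S x \<beta>"
    proof (rule le_hexE)
      fix s U' assume "U' \<le> U" "U' \<le> (T s \<^bold>\<and> (\<^bold>\<forall>i. index X i \<^bold>\<longrightarrow> qnorm X i (sub X x s) \<^bold>< \<beta>))"
      then show "U' \<le> near X S x \<beta>"
        using ST[of U' s] U(1) by (intro le_hexI[of _ _ s]) (auto simp: le_hconj)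
    qed
    then show "U \<le> (far X S x \<alpha> \<^bold>\<or> near X S x \<beta>)" by (rule le_hdisjI2)
  qed
qed

text \<open>All members of \<open>singleton X a\<close> are equal to \<open>a\<close>, so an index
  witnessing the distance of \<open>x\<close> from \<open>a\<close> serves for each of them.\<close>

lemma far_singletonI:
  assumes "W \<le> qnormed_space X" "W \<le> carrier X x" "W \<le> carrier X a"
    "W \<le> (\<^bold>\<exists>i. index X i \<^bold>\<and> \<alpha> \<^bold>< qnorm X i (sub X x a))"
  shows "W \<le> far X (singleton X a) x \<alpha>"
  unfolding le_hall le_himp
proof (intro allI impI)
  fix s V assume V: "V \<le> W" "V \<le> singleton X a s"
  show "V \<le> (\<^bold>\<exists>i. index X i \<^bold>\<and> \<alpha> \<^bold>< qnorm X i (sub X x s))"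
    using order_trans[OF V(1) assms(4)]
  proof (rule le_hexE)
    fix i U assume U: "U \<le> V" "U \<le> (index X i \<^bold>\<and> \<alpha> \<^bold>< qnorm X i (sub X x a))"
    then have "U \<le> W" "U \<le> singleton X a s" using V by auto
    then show "U \<le> (\<^bold>\<exists>i. index X i \<^bold>\<and> \<alpha> \<^bold>< qnorm X i (sub X x s))"
      using U(2) assms(1-3)[THEN order_trans[OF \<open>U \<le> W\<close>]]
        qnorm_sub_less_cong(1)[of U X i x s a \<alpha>]
      by (intro le_hexI[of _ _ i]) (auto simp: le_hconj singleton_def)
  qed
qed

text \<open>The element inside \<open>near\<close> exists only on a cover of \<open>W\<close> and is
  merely equal to \<open>a\<close>; the conclusion mentions \<open>a\<close> alone and can therefore
  be collected back to \<open>W\<close>.\<close>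

lemma near_singletonD:
  assumes "W \<le> qnormed_space X" "W \<le> carrier X x" "W \<le> carrier X a"
    "W \<le> near X (singleton X a) x \<beta>" "W \<le> index X i"
  shows "W \<le> (qnorm X i (sub X x a) \<^bold>< \<beta>)"
  using assms(4)
proof (rule le_hexE)
  fix s V
  assume V: "V \<le> W"
    and *: "V \<le> (singleton X a s \<^bold>\<and> (\<^bold>\<forall>i. index X i \<^bold>\<longrightarrow> qnorm X i (sub X x s) \<^bold>< \<beta>))"
  note fV = assms(1-3,5)[THEN order_trans[OF V]]
  have s: "V \<le> carrier X s" "V \<le> eq X s a" using * by (auto simp: le_hconj singleton_def)
  have "V \<le> eq X a s"
    using qnormed_eq_sym[OF fV(1) s(1) fV(3) s(2)] .
  moreover have "V \<le> (qnorm X i (sub X x s) \<^bold>< \<beta>)"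
    using * fV(4) unfolding forcing by blast
  ultimately show "V \<le> (qnorm X i (sub X x a) \<^bold>< \<beta>)"
    using qnorm_sub_less_cong(2)[of V X i x a s] fV s by blast
qed

lemma singleton_self:
  assumes "W \<le> qnormed_space X" "W \<le> carrier X a"
  shows "W \<le> singleton X a a"
  using assms by (simp add: singleton_def le_hconj qnormed_eq_refl)

section \<open>From locatedness of \<open>{0}\<close> to the existence of norms\<close>

text \<open>Locatedness of \<open>{0}\<close> enters only to show that the cut \<open>c\<close> is
  located. The inhabited index set and boundedness put a rational on either side of
  \<open>c\<close>; the other cut axioms come from the seminorm values and the order of the
  rationals.\<close>

lemma normable_if_located_zer:
  assumes Q: "W \<le> qnormed_space X" and loc: "W \<le> located X (singleton X (zer X))"
    and x: "W \<le> carrier X x"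
  shows "W \<le> normable X x"
proof -
  \<comment> \<open>The margin \<open>r < q\<close> makes the upper cut open: from the single upper
    cuts at \<open>q\<close> alone, infinitely many indices need not give a common smaller
    bound.\<close>
  define c where "c = Cut (\<lambda>q. \<^bold>\<exists>i. index X i \<^bold>\<and> lower (qnorm X i x) q)
    (\<lambda>q. \<^bold>\<exists>r. \<langle>r < q\<rangle> \<^bold>\<and> (\<^bold>\<forall>i. index X i \<^bold>\<longrightarrow> upper (qnorm X i x) r))"
  have lower_c: "lower c q = (\<^bold>\<exists>i. index X i \<^bold>\<and> lower (qnorm X i x) q)" for q
    by (simp add: c_def)
  have upper_c: "upper c q = (\<^bold>\<exists>r. \<langle>r < q\<rangle> \<^bold>\<and> (\<^bold>\<forall>i. index X i \<^bold>\<longrightarrow> upper (qnorm X i x) r))" for q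
    by (simp add: c_def)
  have real: "V \<le> is_real (qnorm X i x)" if "V \<le> W" "V \<le> index X i" for V i
    using that Q x by (intro qnorm_real) auto
  have lower_cI: "V \<le> lower c q" if "V \<le> index X i" "V \<le> lower (qnorm X i x) q" for V i q
    unfolding lower_c using that by (intro le_hexI[of _ _ i]) (simp add: le_hconj)
  have lower_cE: "V \<le> p" if "V \<le> lower c q"
    "\<And>i U. U \<le> V \<Longrightarrow> U \<le> index X i \<Longrightarrow> U \<le> lower (qnorm X i x) q \<Longrightarrow> U \<le> p" for V p q
    using that(1) unfolding lower_c by (rule le_hexE) (auto simp: le_hconj intro: that(2))
  \<comment> \<open>Used twice: for disjointness of the two cuts of \<open>c\<close>, and to show
    that \<open>c\<close> bounds every seminorm value.\<close>
  have le_c: "V \<le> bot" if V: "V \<le> W" "V \<le> index X i" "V \<le> lower (qnorm X i x) q" "V \<le> upper c q"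
    for V i q
    using V(4) unfolding upper_c
  proof (rule le_hex_decidedE)
    fix r U assume U: "U \<le> V" "r < q" "U \<le> (\<^bold>\<forall>i. index X i \<^bold>\<longrightarrow> upper (qnorm X i x) r)"
    then have "U \<le> upper (qnorm X i x) r" "U \<le> lower (qnorm X i x) q" "U \<le> is_real (qnorm X i x)"
      using V real[of U i] by (auto simp: forcing)
    then show "U \<le> bot"
      using U(2) real_lower_less_upper[of U "qnorm X i x" q r bot] by auto
  qed
  have c: "W \<le> is_real c"
  proof (rule is_realI)
    show "W \<le> (\<^bold>\<exists>q. lower c q)"
      using qnormed_index_ex[OF Q]
    proof (rule le_hexE)
      fix i V assume V: "V \<le> W" "V \<le> index X i"
      show "V \<le> (\<^bold>\<exists>q. lower c q)"
        using real_lower_ex[OF real[OF V]]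
        by (rule le_hexE) (rule le_hexI, erule lower_cI[OF order_trans[OF _ V(2)]])
    qed
    show "W \<le> (\<^bold>\<exists>q. upper c q)"
    proof (rule le_hexE[OF qnormed_bounded[OF Q x]], erule le_hexE)
      fix b d V U
      assume V: "V \<le> W" "U \<le> V" "U \<le> (is_real b \<^bold>\<and> is_real d \<^bold>\<and>
        (\<^bold>\<forall>i. index X i \<^bold>\<longrightarrow> b \<^bold>\<le> qnorm X i x \<^bold>\<and> qnorm X i x \<^bold>\<le> d))"
      then have d: "U \<le> is_real d" by (simp add: le_hconj)
      show "U \<le> (\<^bold>\<exists>q. upper c q)"
        using real_upper_ex[OF d]
      proof (rule le_hexE)
        fix q T assume T: "T \<le> U" "T \<le> upper d q"
        have "S \<le> upper (qnorm X i x) q" if S: "S \<le> T" "S \<le> index X i" for S i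
        proof (rule real_le_upper)
          show "S \<le> is_real (qnorm X i x)" using V T S by (intro real) auto
          show "S \<le> is_real d" "S \<le> upper d q" using d T S by auto
          have "S \<le> U" using T S by auto
          with V(3) have "S \<le> (\<^bold>\<forall>i. index X i \<^bold>\<longrightarrow> b \<^bold>\<le> qnorm X i x \<^bold>\<and> qnorm X i x \<^bold>\<le> d)"
            by (auto simp: le_hconj)
          then have "S \<le> (b \<^bold>\<le> qnorm X i x \<^bold>\<and> qnorm X i x \<^bold>\<le> d)"
            unfolding le_hall using S(2) by (auto intro: le_himpD)
          then show "S \<le> (qnorm X i x \<^bold>\<le> d)" by (simp add: le_hconj)
        qed
        \<comment> \<open>The rational \<open>q\<close> bounds all seminorm values of
          \<open>x\<close>; moving to \<open>q + 1\<close> provides the margin demanded by the upper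
          cut.\<close>
        then show "T \<le> (\<^bold>\<exists>q. upper c q)"
          by (intro le_hexI[of _ _ "q + 1"]) (auto simp: upper_c forcing intro!: le_hex_decidedI[of _ q])
      qed
    qed
  next
    fix V q assume "V \<le> W" "V \<le> lower c q"
    from this(2) show "V \<le> (\<^bold>\<exists>r. \<langle>q < r\<rangle> \<^bold>\<and> lower c r)"
    proof (rule lower_cE)
      fix i U assume U: "U \<le> V" "U \<le> index X i" "U \<le> lower (qnorm X i x) q"
      then have "U \<le> is_real (qnorm X i x)" using \<open>V \<le> W\<close> real by auto
      then show "U \<le> (\<^bold>\<exists>r. \<langle>q < r\<rangle> \<^bold>\<and> lower c r)"
        by (rule real_lower_open[OF _ U(3), THEN le_hex_decidedE])
          (erule le_hex_decidedI, erule lower_cI[OF order_trans[OF _ U(2)]])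
    qed
  next
    fix V and q r :: rat assume V: "V \<le> W" "q < r" "V \<le> lower c r"
    from V(3) show "V \<le> lower c q"
    proof (rule lower_cE)
      fix i U assume "U \<le> V" "U \<le> index X i" "U \<le> lower (qnorm X i x) r"
      then show "U \<le> lower c q"
        using real_lower_mono[OF real V(2)] V(1) by (intro lower_cI[of U i]) auto
    qed
  next
    fix V q assume "V \<le> upper c q"
    then show "V \<le> (\<^bold>\<exists>r. \<langle>r < q\<rangle> \<^bold>\<and> upper c r)"
      unfolding upper_c
    proof (rule le_hex_decidedE)
      fix r U assume *: "r < q" "U \<le> (\<^bold>\<forall>i. index X i \<^bold>\<longrightarrow> upper (qnorm X i x) r)"
      obtain s where "r < s" "s < q" using dense[OF *(1)] by blast
      with *(2) show "U \<le> (\<^bold>\<exists>s. \<langle>s < q\<rangle> \<^bold>\<and>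
          (\<^bold>\<exists>r. \<langle>r < s\<rangle> \<^bold>\<and> (\<^bold>\<forall>i. index X i \<^bold>\<longrightarrow> upper (qnorm X i x) r)))"
        by (intro le_hex_decidedI[of _ s] le_hex_decidedI[of _ r])
    qed
  next
    fix V and q r :: rat assume V: "r < q" "V \<le> upper c r"
    from V(2) show "V \<le> upper c q"
      unfolding upper_c
    proof (rule le_hex_decidedE)
      fix s U assume "s < r" "U \<le> (\<^bold>\<forall>i. index X i \<^bold>\<longrightarrow> upper (qnorm X i x) s)"
      then show "U \<le> (\<^bold>\<exists>s. \<langle>s < q\<rangle> \<^bold>\<and> (\<^bold>\<forall>i. index X i \<^bold>\<longrightarrow> upper (qnorm X i x) s))"
        using V(1) by (intro le_hex_decidedI[of _ s]) auto
    qed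
  next
    fix V q assume V: "V \<le> W" "V \<le> lower c q" "V \<le> upper c q"
    from V(2) show "V \<le> bot"
      by (rule lower_cE) (rule le_c[OF order_trans[OF _ V(1)] _ _ order_trans[OF _ V(3)]], assumption+)
  next
    fix q r :: rat assume "q < r"
    \<comment> \<open>Locatedness is applied to \<open>q < s\<close> rather than
      \<open>q < r\<close>, which leaves the gap \<open>s < r\<close> as the margin for the upper
      cut.\<close>
    then obtain s where s: "q < s" "s < r" using dense by blast
    have "W \<le> (rat_cut q \<^bold>< rat_cut s)"
      using s(1) by (simp add: rat_cut_less_iff real_rat_cut lower_rat_cut le_decidedI)
    with locatedD[OF loc x real_rat_cut real_rat_cut]
    have "W \<le> (far X (singleton X (zer X)) x (rat_cut q) \<^bold>\<or> near X (singleton X (zer X)) x (rat_cut s))"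
      by blast
    then show "W \<le> (lower c q \<^bold>\<or> upper c r)"
    proof (rule le_hdisjE)
      fix V assume V: "V \<le> W" "V \<le> far X (singleton X (zer X)) x (rat_cut q)"
      \<comment> \<open>Being far from the set is used at its member \<open>0\<close>, where
        \<open>x - 0\<close> may be replaced by \<open>x\<close>.\<close>
      have "V \<le> singleton X (zer X) (zer X)"
        by (intro singleton_self qnormed_zer order_trans[OF V(1) Q])
      then have "V \<le> (\<^bold>\<exists>i. index X i \<^bold>\<and> rat_cut q \<^bold>< qnorm X i (sub X x (zer X)))"
        by (rule le_himpD[OF V(2)[unfolded le_hall, rule_format]])
      then have "V \<le> lower c q"
      proof (rule le_hexE)
        fix i U assume U: "U \<le> V" "U \<le> (index X i \<^bold>\<and> rat_cut q \<^bold>< qnorm X i (sub X x (zer X)))"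
        have UW: "U \<le> W" using U V by auto
        note f = Q[THEN order_trans[OF UW]] x[THEN order_trans[OF UW]]
        note z = qnormed_sub[OF f(1,2) qnormed_zer[OF f(1)]]
        have i: "U \<le> index X i" using U(2) by (simp add: le_hconj)
        have "U \<le> lower (qnorm X i (sub X x (zer X))) q"
          using U(2) rat_cut_less_iff[OF qnorm_real[OF f(1) i z]] by (simp add: le_hconj)
        then show "U \<le> lower c q"
          using lower_qnorm_cong[OF f(1) i z f(2) qnormed_sub_zer[OF f]] i by (blast intro: lower_cI)
      qed
      then show "V \<le> (lower c q \<^bold>\<or> upper c r)" by (rule le_hdisjI1)
    next
      fix V assume V: "V \<le> W" "V \<le> near X (singleton X (zer X)) x (rat_cut s)"
      have "U \<le> upper (qnorm X i x) s" if U: "U \<le> V" "U \<le> index X i" for U i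
      proof -
        have UW: "U \<le> W" using U V by auto
        note f = Q[THEN order_trans[OF UW]] x[THEN order_trans[OF UW]]
        note z = qnormed_sub[OF f(1,2) qnormed_zer[OF f(1)]]
        have "U \<le> (qnorm X i (sub X x (zer X)) \<^bold>< rat_cut s)"
          by (rule near_singletonD[OF f qnormed_zer[OF f(1)] order_trans[OF U(1) V(2)] U(2)])
        then have "U \<le> upper (qnorm X i (sub X x (zer X))) s"
          using less_rat_cut_iff[OF qnorm_real[OF f(1) U(2) z]] by blast
        then show ?thesis
          using upper_qnorm_cong[OF f(1) U(2) z f(2) qnormed_sub_zer[OF f]] by blast
      qed
      then have "V \<le> upper c r"
        unfolding upper_c using s(2) by (intro le_hex_decidedI[of _ s]) (auto simp: forcing)
      then show "V \<le> (lower c q \<^bold>\<or> upper c r)" by (rule le_hdisjI2)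
    qed
  qed
  have "W \<le> (\<^bold>\<forall>i. index X i \<^bold>\<longrightarrow> qnorm X i x \<^bold>\<le> c)"
    unfolding le_hall le_himp
  proof (intro allI impI real_leI)
    fix i V U q
    assume "V \<le> W" "V \<le> index X i" "U \<le> V" "U \<le> lower (qnorm X i x) q" "U \<le> upper c q"
    then show "U \<le> bot" by (intro le_c[of U i q]) auto
  qed
  moreover have "V \<le> (\<^bold>\<exists>i. index X i \<^bold>\<and> c - \<epsilon> \<^bold>< qnorm X i x)"
    if V: "V \<le> W" and e: "V \<le> is_real \<epsilon>" "V \<le> (0 \<^bold>< \<epsilon>)" for V \<epsilon>
  proof -
    have "V \<le> lower \<epsilon> 0" using e by (simp add: zero_cut_eq rat_cut_less_iff)
    then show ?thesis
    proof (rule real_lower_open[OF e(1), THEN le_hex_decidedE])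
      fix e U assume U: "U \<le> V" "0 < e" "U \<le> lower \<epsilon> e"
      have cU: "U \<le> is_real c" using c U V by auto
      show "U \<le> (\<^bold>\<exists>i. index X i \<^bold>\<and> c - \<epsilon> \<^bold>< qnorm X i x)"
      \<comment> \<open>Take a bracket \<open>q < c < r\<close> shorter than a rational
        \<open>e\<close> with \<open>0 < e < \<epsilon>\<close>. Then \<open>r - e < q\<close>, so
        \<open>q\<close> lies above \<open>c - \<epsilon>\<close>, while \<open>q < c\<close>
        provides an index whose seminorm value exceeds \<open>q\<close>.\<close>
      proof (rule le_hexE[OF real_approx[OF cU U(2)]], erule le_hex_decidedE)
        fix q r T T'
        assume T: "T \<le> U" "T' \<le> T" "r - q < e" "T' \<le> (lower c q \<^bold>\<and> upper c r)"
        then have "T' \<le> lower c q" by (simp add: le_hconj)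
        then show "T' \<le> (\<^bold>\<exists>i. index X i \<^bold>\<and> c - \<epsilon> \<^bold>< qnorm X i x)"
        proof (rule lower_cE)
          fix i S assume S: "S \<le> T'" "S \<le> index X i" "S \<le> lower (qnorm X i x) q"
          have "S \<le> upper (c - \<epsilon>) q"
            using T S U by (intro upper_minus_cutI[of S c r \<epsilon> e]) (auto simp: le_hconj)
          then show "S \<le> (\<^bold>\<exists>i. index X i \<^bold>\<and> c - \<epsilon> \<^bold>< qnorm X i x)"
            using S by (intro le_hexI[of _ _ i]) (auto simp: le_hconj intro: real_lessI)
        qed
      qed
    qed
  qed
  ultimately show ?thesis
    unfolding normable_def using c by (intro le_hexI[of _ _ c]) (auto simp: forcing)
qed

section \<open>From norms to located singletons\<close>

text \<open>Restates the supremum property for rationals: with \<open>q < r < c\<close> and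
  \<open>\<epsilon> = r - q\<close>, the value \<open>c - \<epsilon>\<close> is still above
  \<open>q\<close>.\<close>

lemma norm_approx:
  assumes Q: "W \<le> qnormed_space X" and x: "W \<le> carrier X x" and c: "W \<le> is_real c"
    and sup: "W \<le> (\<^bold>\<forall>\<epsilon>. is_real \<epsilon> \<^bold>\<and> 0 \<^bold>< \<epsilon> \<^bold>\<longrightarrow> (\<^bold>\<exists>i. index X i \<^bold>\<and> c - \<epsilon> \<^bold>< qnorm X i x))"
    and q: "W \<le> lower c q"
  shows "W \<le> (\<^bold>\<exists>i. index X i \<^bold>\<and> lower (qnorm X i x) q)"
  using real_lower_open[OF c q]
proof (rule le_hex_decidedE)
  fix r V assume V: "V \<le> W" "q < r" "V \<le> lower c r"
  have "V \<le> (0 \<^bold>< rat_cut (r - q))"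
    using V(2) by (simp add: zero_cut_eq rat_cut_less_iff real_rat_cut lower_rat_cut le_decidedI)
  then have "V \<le> (is_real (rat_cut (r - q)) \<^bold>\<and> 0 \<^bold>< rat_cut (r - q))"
    by (simp add: le_hconj real_rat_cut)
  then have "V \<le> (\<^bold>\<exists>i. index X i \<^bold>\<and> c - rat_cut (r - q) \<^bold>< qnorm X i x)"
    by (rule le_himpD[OF order_trans[OF V(1) sup, unfolded le_hall, rule_format]])
  then show "V \<le> (\<^bold>\<exists>i. index X i \<^bold>\<and> lower (qnorm X i x) q)"
  proof (rule le_hexE)
    fix i U assume U: "U \<le> V" "U \<le> (index X i \<^bold>\<and> c - rat_cut (r - q) \<^bold>< qnorm X i x)"
    then have i: "U \<le> index X i" and "U \<le> (c - rat_cut (r - q) \<^bold>< qnorm X i x)"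
      by (auto simp: le_hconj)
    from this(2) have "U \<le> lower (qnorm X i x) q"
    proof (rule real_lessE)
      fix T t assume T: "T \<le> U" "T \<le> upper (c - rat_cut (r - q)) t" "T \<le> lower (qnorm X i x) t"
      from T(2) show "T \<le> lower (qnorm X i x) q"
      proof (rule upper_minus_cutE)
        fix S a b
        assume S: "S \<le> T" "a - b < t" "S \<le> upper c a" "S \<le> lower (rat_cut (r - q)) b"
        have SW: "S \<le> W" "S \<le> V" using S T U V by auto
        have real: "S \<le> is_real (qnorm X i x)"
          using Q x i S(1) T(1) SW(1) by (intro qnorm_real) auto
        from S(4) show "S \<le> lower (qnorm X i x) q"
          unfolding lower_rat_cut
        \<comment> \<open>Here \<open>r < c < a\<close> and \<open>b < r - q\<close>, so
          \<open>t > a - b > r - (r - q) = q\<close>, and \<open>t\<close> is below the seminorm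
          value.\<close>
        proof (rule le_decidedE)
          assume b: "b < r - q"
          show "S \<le> lower (qnorm X i x) q"
          proof (rule real_lower_less_upper[of S c r a])
            show "S \<le> is_real c" "S \<le> lower c r" "S \<le> upper c a"
              using c V(3) S(3) SW by auto
            assume "r < a"
            then have "q < t" using b S(2) by simp
            then show "S \<le> lower (qnorm X i x) q"
              by (rule real_lower_mono[OF real]) (rule order_trans[OF S(1) T(3)])
          qed
        qed
      qed
    qed
    with i show "U \<le> (\<^bold>\<exists>i. index X i \<^bold>\<and> lower (qnorm X i x) q)"
      by (intro le_hexI[of _ _ i]) (simp add: le_hconj)
  qed
qed

lemma located_singleton_if_normable:
  assumes Q: "W \<le> qnormed_space X" and norm: "W \<le> (\<^bold>\<forall>x. carrier X x \<^bold>\<longrightarrow> normable X x)"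
    and a: "W \<le> carrier X a"
  shows "W \<le> located X (singleton X a)"
proof (rule locatedI)
  fix V x \<alpha> \<beta>
  assume V: "V \<le> W" "V \<le> carrier X x" "V \<le> is_real \<alpha>" "V \<le> is_real \<beta>" "V \<le> (\<alpha> \<^bold>< \<beta>)"
  let ?S = "singleton X a"
  have QV: "V \<le> qnormed_space X" and aV: "V \<le> carrier X a" using Q a V(1) by auto
  have d: "V \<le> carrier X (sub X x a)" using qnormed_sub[OF QV V(2) aV] .
  have "V \<le> normable X (sub X x a)"
    using d by (rule le_himpD[OF order_trans[OF V(1) norm, unfolded le_hall, rule_format]])
  then show "V \<le> (far X ?S x \<alpha> \<^bold>\<or> near X ?S x \<beta>)"
    unfolding normable_def
  proof (rule le_hexE)
    fix c U
    assume U: "U \<le> V" and *: "U \<le> (is_real c \<^bold>\<and>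
       (\<^bold>\<forall>i. index X i \<^bold>\<longrightarrow> qnorm X i (sub X x a) \<^bold>\<le> c) \<^bold>\<and>
       (\<^bold>\<forall>\<epsilon>. is_real \<epsilon> \<^bold>\<and> 0 \<^bold>< \<epsilon> \<^bold>\<longrightarrow>
         (\<^bold>\<exists>i. index X i \<^bold>\<and> c - \<epsilon> \<^bold>< qnorm X i (sub X x a))))"
    note c = *[unfolded le_hconj]
    show "U \<le> (far X ?S x \<alpha> \<^bold>\<or> near X ?S x \<beta>)"
      using order_trans[OF U V(5)]
    proof (rule real_lessE)
      fix r T assume T: "T \<le> U" "T \<le> upper \<alpha> r" "T \<le> lower \<beta> r"
      have "T \<le> is_real \<alpha>" using T U V by auto
      then show "T \<le> (far X ?S x \<alpha> \<^bold>\<or> near X ?S x \<beta>)"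
      proof (rule real_upper_open[OF _ T(2), THEN le_hex_decidedE])
        \<comment> \<open>Openness of the upper cut of \<alpha> gives a second rational, so that
          \<open>\<alpha> < q < r < \<beta>\<close>; the norm \<open>c\<close> is then compared with
          the gap from \<open>q\<close> to \<open>r\<close>.\<close>
        fix q R assume R: "R \<le> T" "q < r" "R \<le> upper \<alpha> q"
        have "R \<le> U" using R T by auto
        then have "R \<le> is_real c" using c by auto
        from real_located[OF this R(2)] show "R \<le> (far X ?S x \<alpha> \<^bold>\<or> near X ?S x \<beta>)"
        proof (rule le_hdisjE)
          fix P assume P: "P \<le> R" "P \<le> lower c q"
          have PU: "P \<le> U" and PV: "P \<le> V" using P \<open>R \<le> U\<close> U by auto
          note f = QV[THEN order_trans[OF PV]] d[THEN order_trans[OF PV]]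
          \<comment> \<open>If \<open>q < c\<close>, some seminorm value of \<open>x - a\<close>
            exceeds \<open>q\<close> and hence \<alpha>, so \<open>x\<close> is far from
            \<open>a\<close>.\<close>
          have "P \<le> (\<^bold>\<exists>i. index X i \<^bold>\<and> lower (qnorm X i (sub X x a)) q)"
            using c PU P(2) by (intro norm_approx[OF f, of c]) auto
          then have "P \<le> (\<^bold>\<exists>i. index X i \<^bold>\<and> \<alpha> \<^bold>< qnorm X i (sub X x a))"
          proof (rule le_hexE)
            fix i P' assume "P' \<le> P" "P' \<le> (index X i \<^bold>\<and> lower (qnorm X i (sub X x a)) q)"
            then show "P' \<le> (\<^bold>\<exists>i. index X i \<^bold>\<and> \<alpha> \<^bold>< qnorm X i (sub X x a))"
              using P(1) R(3) by (intro le_hexI[of _ _ i]) (auto simp: le_hconj intro!: real_lessI[of _ _ q])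
          qed
          then have "P \<le> far X ?S x \<alpha>"
            by (rule far_singletonI[OF f(1) order_trans[OF PV V(2)] order_trans[OF PV aV]])
          then show "P \<le> (far X ?S x \<alpha> \<^bold>\<or> near X ?S x \<beta>)" by (rule le_hdisjI1)
        next
          fix P assume P: "P \<le> R" "P \<le> upper c r"
          have PU: "P \<le> U" and PV: "P \<le> V" and PT: "P \<le> T" using P R \<open>R \<le> U\<close> U by auto
          \<comment> \<open>If \<open>c < r\<close>, every seminorm value of \<open>x - a\<close> is
            at most \<open>c\<close>, thus below \<open>r < \<beta>\<close>, and \<open>a\<close>
            itself is the near point.\<close>
          have "P' \<le> (qnorm X i (sub X x a) \<^bold>< \<beta>)" if P': "P' \<le> P" "P' \<le> index X i" for P' i
          proof (rule real_lessI)
            show "P' \<le> lower \<beta> r" using T(3) P'(1) PT by auto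
            have "P' \<le> V" "P' \<le> U" using P'(1) PV PU by auto
            show "P' \<le> upper (qnorm X i (sub X x a)) r"
            proof (rule real_le_upper)
              show "P' \<le> is_real (qnorm X i (sub X x a))"
                using \<open>P' \<le> V\<close> QV d P'(2) by (intro qnorm_real) auto
              show "P' \<le> is_real c" using c \<open>P' \<le> U\<close> by auto
              show "P' \<le> (qnorm X i (sub X x a) \<^bold>\<le> c)"
                using c \<open>P' \<le> U\<close> P'(2) by (auto simp: le_hall le_himp)
              show "P' \<le> upper c r" using P P' by auto
            qed
          qed
          then have "P \<le> near X ?S x \<beta>"
            using singleton_self[OF order_trans[OF PV QV] order_trans[OF PV aV]]
            by (intro le_hexI[of _ _ a]) (auto simp: forcing)
          then show "P \<le> (far X ?S x \<alpha> \<^bold>\<or> near X ?S x \<beta>)" by (rule le_hdisjI2)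
        qed
      qed
    qed
  qed
qed

section \<open>Singleton subsets and finitely enumerable sets\<close>

lemma singleton_subset_singleton:
  assumes "W \<le> carrier X a"
  shows "W \<le> is_singleton_subset X (singleton X a)"
  unfolding is_singleton_subset_def
  by (rule le_hexI[of _ _ a]) (simp add: forcing assms)

lemma located_singleton_subset_if_normable:
  assumes "W \<le> qnormed_space X" "W \<le> (\<^bold>\<forall>x. carrier X x \<^bold>\<longrightarrow> normable X x)"
    "W \<le> is_singleton_subset X S"
  shows "W \<le> located X S"
  using assms(3) unfolding is_singleton_subset_def
proof (rule le_hexE)
  fix a V assume "V \<le> W" "V \<le> (carrier X a \<^bold>\<and> (\<^bold>\<forall>x. S x \<^bold>\<longleftrightarrow> singleton X a x))"
  then show "V \<le> located X S"
    using assms(1,2)[THEN order_trans[OF \<open>V \<le> W\<close>]]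
    by (intro located_cong[of V S "singleton X a"] located_singleton_if_normable) (simp_all add: le_hconj)
qed

lemma finitely_enumerable_if_singleton_subset:
  assumes "W \<le> is_singleton_subset X S"
  shows "W \<le> finitely_enumerable X S"
  using assms unfolding is_singleton_subset_def
proof (rule le_hexE)
  fix a V assume V: "V \<le> W" "V \<le> (carrier X a \<^bold>\<and> (\<^bold>\<forall>x. S x \<^bold>\<longleftrightarrow> singleton X a x))"
  \<comment> \<open>A singleton is enumerated with \<open>n = 1\<close> by a constant function, so
    the quantifier over \<open>k\<close> collapses.\<close>
  have "(\<^bold>\<exists>k. \<langle>1 \<le> k \<and> k \<le> (1::nat)\<rangle> \<^bold>\<and> eq X x a) = eq X x a" for x
  proof (rule antisym)
    show "(\<^bold>\<exists>k. \<langle>1 \<le> k \<and> k \<le> (1::nat)\<rangle> \<^bold>\<and> eq X x a) \<le> eq X x a"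
      by (rule le_hex_decidedE[OF order_refl])
    show "eq X x a \<le> (\<^bold>\<exists>k. \<langle>1 \<le> k \<and> k \<le> (1::nat)\<rangle> \<^bold>\<and> eq X x a)"
      by (rule le_hex_decidedI[of _ 1]) auto
  qed
  with V show "V \<le> finitely_enumerable X S"
    unfolding finitely_enumerable_def
    by (intro le_hexI[of _ _ 1] le_hexI[of _ _ "\<lambda>_. a"]) (auto simp: forcing singleton_def)
qed

text \<open>\<open>S\<close> is the union of the sets \<open>singleton X (f k)\<close>: it is far
  from \<open>x\<close> if all of them are and near if one of them is. For \<open>n = 0\<close> the
  first alternative holds vacuously.\<close>

lemma located_finitely_enumerable:
  assumes Q: "W \<le> qnormed_space X"
    and loc: "W \<le> (\<^bold>\<forall>S. is_singleton_subset X S \<^bold>\<longrightarrow> located X S)"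
    and fin: "W \<le> finitely_enumerable X S"
  shows "W \<le> located X S"
proof (rule locatedI)
  fix V x \<alpha> \<beta>
  assume V: "V \<le> W" "V \<le> carrier X x" "V \<le> is_real \<alpha>" "V \<le> is_real \<beta>" "V \<le> (\<alpha> \<^bold>< \<beta>)"
  show "V \<le> (far X S x \<alpha> \<^bold>\<or> near X S x \<beta>)"
  proof (rule le_hexE[OF order_trans[OF V(1) fin, unfolded finitely_enumerable_def]], erule le_hexE)
    fix n :: nat and f U' U
    assume UU: "U' \<le> V" "U \<le> U'"
      and *: "U \<le> ((\<^bold>\<forall>k. \<langle>1 \<le> k \<and> k \<le> n\<rangle> \<^bold>\<longrightarrow> carrier X (f k)) \<^bold>\<and>
       (\<^bold>\<forall>x. S x \<^bold>\<longleftrightarrow> carrier X x \<^bold>\<and> (\<^bold>\<exists>k. \<langle>1 \<le> k \<and> k \<le> n\<rangle> \<^bold>\<and> eq X x (f k))))"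
    have UV: "U \<le> V" using UU by auto
    let ?S = "\<lambda>k. singleton X (f k)"
    have f: "U \<le> carrier X (f k)" if "k \<in> {1..n}" for k
      using * that by (auto simp: le_hconj le_hall intro: le_himpD le_decidedI)
    have S: "T \<le> S s \<longleftrightarrow> T \<le> carrier X s \<and> T \<le> (\<^bold>\<exists>k. \<langle>1 \<le> k \<and> k \<le> n\<rangle> \<^bold>\<and> eq X s (f k))"
      if "T \<le> U" for T s
      using * that by (auto simp: forcing)
    have "U \<le> ((\<^bold>\<forall>k. \<langle>k \<in> {1..n}\<rangle> \<^bold>\<longrightarrow> far X (?S k) x \<alpha>) \<^bold>\<or>
        (\<^bold>\<exists>k. \<langle>k \<in> {1..n}\<rangle> \<^bold>\<and> near X (?S k) x \<beta>))"
    proof (rule le_finite_hdisj)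
      fix k assume "k \<in> {1..n}"
      then have "U \<le> located X (?S k)"
        by (intro le_himpD[OF order_trans[OF UV order_trans[OF V(1) loc], unfolded le_hall, rule_format]]
            singleton_subset_singleton f)
      then show "U \<le> (far X (?S k) x \<alpha> \<^bold>\<or> near X (?S k) x \<beta>)"
        by (rule locatedD) (rule order_trans[OF UV], rule V)+
    qed simp
    then show "U \<le> (far X S x \<alpha> \<^bold>\<or> near X S x \<beta>)"
    proof (rule le_hdisjE)
      fix T assume T: "T \<le> U" "T \<le> (\<^bold>\<forall>k. \<langle>k \<in> {1..n}\<rangle> \<^bold>\<longrightarrow> far X (?S k) x \<alpha>)"
      \<comment> \<open>A member of \<open>S\<close> equals some \<open>f k\<close>, hence lies in
        \<open>singleton X (f k)\<close>, and the hypothesis for this \<open>k\<close> supplies the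
        index.\<close>
      have "R \<le> (\<^bold>\<exists>i. index X i \<^bold>\<and> \<alpha> \<^bold>< qnorm X i (sub X x s))" if R: "R \<le> T" "R \<le> S s" for R s
      proof -
        have s: "R \<le> carrier X s" and "R \<le> (\<^bold>\<exists>k. \<langle>1 \<le> k \<and> k \<le> n\<rangle> \<^bold>\<and> eq X s (f k))"
          using S[of R s] R T by auto
        from this(2) show ?thesis
        proof (rule le_hex_decidedE)
          fix k P assume P: "P \<le> R" "1 \<le> k \<and> k \<le> n" "P \<le> eq X s (f k)"
          have PT: "P \<le> T" using P R by auto
          have "P \<le> \<langle>k \<in> {1..n}\<rangle>" using P(2) by (simp add: le_decidedI)
          with PT T(2) have "P \<le> far X (?S k) x \<alpha>" unfolding le_hall le_himp[of T] by blast
          moreover have "P \<le> ?S k s" using P s by (auto simp: singleton_def le_hconj)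
          ultimately show "P \<le> (\<^bold>\<exists>i. index X i \<^bold>\<and> \<alpha> \<^bold>< qnorm X i (sub X x s))"
            unfolding le_hall by (blast intro: le_himpD)
        qed
      qed
      then have "T \<le> far X S x \<alpha>" by (simp add: le_hall le_himp)
      then show "T \<le> (far X S x \<alpha> \<^bold>\<or> near X S x \<beta>)" by (rule le_hdisjI1)
    next
      fix T assume T: "T \<le> U" "T \<le> (\<^bold>\<exists>k. \<langle>k \<in> {1..n}\<rangle> \<^bold>\<and> near X (?S k) x \<beta>)"
      from T(2) have "T \<le> near X S x \<beta>"
      proof (rule le_hex_decidedE)
        fix k R assume R: "R \<le> T" "k \<in> {1..n}" "R \<le> near X (?S k) x \<beta>"
        from R(3) show "R \<le> near X S x \<beta>"
        proof (rule le_hexE)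
          fix s P
          assume P: "P \<le> R" "P \<le> (?S k s \<^bold>\<and> (\<^bold>\<forall>i. index X i \<^bold>\<longrightarrow> qnorm X i (sub X x s) \<^bold>< \<beta>))"
          then have "P \<le> carrier X s" "P \<le> eq X s (f k)" by (auto simp: le_hconj singleton_def)
          \<comment> \<open>The near element need not be \<open>f k\<close> itself, but being equal
            to it, it belongs to \<open>S\<close>.\<close>
          then have "P \<le> S s"
            using S[of P s] P(1) R T(1) by (auto intro: le_hex_decidedI[of _ k])
          then show "P \<le> near X S x \<beta>"
            using P(2) by (intro le_hexI[of _ _ s]) (simp add: le_hconj)
        qed
      qed
      then show "T \<le> (far X S x \<alpha> \<^bold>\<or> near X S x \<beta>)" by (rule le_hdisjI2)
    qed
  qed
qed

theorem proposition5:
  fixes X :: "('h::frame, 'x, 'i) qnormed"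
  shows "\<Turnstile> qnormed_space X \<^bold>\<longrightarrow>
    (located X (singleton X (zer X))
      \<^bold>\<longleftrightarrow> (\<^bold>\<forall>x. carrier X x \<^bold>\<longrightarrow> normable X x)) \<^bold>\<and>
    ((\<^bold>\<forall>x. carrier X x \<^bold>\<longrightarrow> normable X x)
      \<^bold>\<longleftrightarrow> (\<^bold>\<forall>S. is_singleton_subset X S \<^bold>\<longrightarrow> located X S)) \<^bold>\<and>
    ((\<^bold>\<forall>S. is_singleton_subset X S \<^bold>\<longrightarrow> located X S)
      \<^bold>\<longleftrightarrow> (\<^bold>\<forall>S. finitely_enumerable X S \<^bold>\<longrightarrow> located X S))"
proof -
  let ?i = "located X (singleton X (zer X))"
  let ?ii = "\<^bold>\<forall>x. carrier X x \<^bold>\<longrightarrow> normable X x"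
  let ?iii = "\<^bold>\<forall>S. is_singleton_subset X S \<^bold>\<longrightarrow> located X S"
  let ?iv = "\<^bold>\<forall>S. finitely_enumerable X S \<^bold>\<longrightarrow> located X S"
  \<comment> \<open>At a fixed stage it suffices to prove the cycle (i), (ii), (iii), (i) and both
    directions between (iii) and (iv).\<close>
  have "(W \<le> ?i \<longleftrightarrow> W \<le> ?ii) \<and> (W \<le> ?ii \<longleftrightarrow> W \<le> ?iii) \<and> (W \<le> ?iii \<longleftrightarrow> W \<le> ?iv)"
    if Q: "W \<le> qnormed_space X" for W
  proof -
    have "W \<le> ?ii" if "W \<le> ?i"
      unfolding le_hall le_himp by (meson normable_if_located_zer order_trans Q that)
    moreover have "W \<le> ?iii" if "W \<le> ?ii"
      using located_singleton_subset_if_normable order_trans[OF _ Q] order_trans[OF _ that]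
      unfolding le_hall[of W "\<lambda>S. is_singleton_subset X S \<^bold>\<longrightarrow> located X S"] le_himp[of W "is_singleton_subset X _"]
      by blast
    moreover have "W \<le> ?i" if "W \<le> ?iii"
      using that singleton_subset_singleton[OF qnormed_zer[OF Q]]
      unfolding le_hall by (blast intro: le_himpD)
    moreover have "W \<le> ?iv" if "W \<le> ?iii"
      using located_finitely_enumerable order_trans[OF _ Q] order_trans[OF _ that]
      unfolding le_hall[of W "\<lambda>S. finitely_enumerable X S \<^bold>\<longrightarrow> located X S"] le_himp[of W "finitely_enumerable X _"]
      by blast
    moreover have "W \<le> ?iii" if "W \<le> ?iv"
      using that finitely_enumerable_if_singleton_subset unfolding le_hall le_himp by blast
    ultimately show ?thesis by blast
  qed
  \<comment> \<open>The equivalences hold at every stage forcing \<open>qnormed_space X\<close>, in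
    particular at all stages below a given one, as forcing an internal equivalence requires.\<close>
  then show ?thesis
    unfolding le_valid le_himp[of _ "qnormed_space X"] le_hconj le_hiff
    by (meson order_trans)
qed

end
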